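(* (In $\mathsf{ZF}$.) For every set $A$, the following are equivalent: (i) $\mathscr{B}(A)$ is Dedekind infinite; (ii) $\mathrm{ns}(P)$ is power Dedekind infinite for some $P\in\mathscr{B}(A)$; (iii) there is an injection from $\mathscr{P}(\omega)$ into $\mathscr{B}(A)$.
   Context: Work in $\mathsf{ZF}$. A partition is finitary if all its blocks are finite; $\mathscr{B}(A)$ is the set of finitary partitions of $A$. For a partition $P$, $\mathrm{ns}(P)$ is the set of blocks of $P$ with more than one element. A set $X$ is Dedekind infinite if there is an injection from $\omega$ into $X$; $X$ is power Dedekind infinite if $\mathscr{P}(X)$ is Dedekind infinite. *)

theory Defs
  imports Main
begin

text \<open>
  The theorem is a theorem of ZF, without the axiom of choice. In HOL itself choice is available and
  would make the three conditions easy to compare, so HOL sets cannot stand for the sets of the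
  theorem. Instead, the metatheory only supplies an arbitrary first-order structure \<open>(M, \<epsilon>)\<close>
  satisfying the ZF axioms, and every set-theoretic notion below is the one internal to that
  structure: each quantifier over sets, functions, natural numbers etc. ranges over the elements
  of \<open>M\<close>. A first-order sentence holds in all such structures iff ZF proves it (completeness
  theorem). Separation and replacement are therefore required for first-order formulas with
  parameters only; for arbitrary HOL predicates they would import the choice of HOL into \<open>M\<close>.
\<close>

section \<open>First-order formulas of set theory\<close>

text \<open>De Bruijn indices: \<open>FAll\<close> binds index 0 and shifts the environment.\<close>

datatype fm = FMem nat nat | FEq nat nat | FNeg fm | FConj fm fm | FAll fm

primrec sat :: "('m \<Rightarrow> 'm \<Rightarrow> bool) \<Rightarrow> fm \<Rightarrow> (nat \<Rightarrow> 'm) \<Rightarrow> bool" where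
  "sat E (FMem i j) e \<longleftrightarrow> E (e i) (e j)"
| "sat E (FEq i j) e \<longleftrightarrow> e i = e j"
| "sat E (FNeg p) e \<longleftrightarrow> \<not> sat E p e"
| "sat E (FConj p q) e \<longleftrightarrow> sat E p e \<and> sat E q e"
| "sat E (FAll p) e \<longleftrightarrow> (\<forall>x. sat E p (case_nat x e))"


section \<open>Set-theoretic notions inside a structure\<close>

locale set_structure =
  fixes mem :: "'m \<Rightarrow> 'm \<Rightarrow> bool"  (infix "\<epsilon>" 50)
begin

text \<open>
  The element of \<open>M\<close> whose \<open>\<epsilon>\<close>-elements are exactly the \<open>x\<close> with \<open>P x\<close>. It is unspecified if there
  is none; for all uses below it exists in models of ZF (see the end of this theory).
\<close>

definition coll :: "('m \<Rightarrow> bool) \<Rightarrow> 'm" where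
  "coll P = (THE b. \<forall>x. x \<epsilon> b \<longleftrightarrow> P x)"

definition subset_of :: "'m \<Rightarrow> 'm \<Rightarrow> bool"  (infix "\<sqsubseteq>" 50) where
  "x \<sqsubseteq> y \<longleftrightarrow> (\<forall>z. z \<epsilon> x \<longrightarrow> z \<epsilon> y)"

definition pow :: "'m \<Rightarrow> 'm" where
  "pow x = coll (\<lambda>y. y \<sqsubseteq> x)"

definition upair :: "'m \<Rightarrow> 'm \<Rightarrow> 'm" where
  "upair a b = coll (\<lambda>x. x = a \<or> x = b)"

definition opair :: "'m \<Rightarrow> 'm \<Rightarrow> 'm" where
  "opair a b = upair (upair a a) (upair a b)"

definition emptyset :: "'m" where
  "emptyset = coll (\<lambda>x. False)"

definition succ :: "'m \<Rightarrow> 'm" where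
  "succ x = coll (\<lambda>y. y \<epsilon> x \<or> y = x)"

definition is_inductive :: "'m \<Rightarrow> bool" where
  "is_inductive I \<longleftrightarrow> emptyset \<epsilon> I \<and> (\<forall>x. x \<epsilon> I \<longrightarrow> succ x \<epsilon> I)"

definition omega :: "'m" where
  "omega = coll (\<lambda>n. \<forall>I. is_inductive I \<longrightarrow> n \<epsilon> I)"

definition is_function :: "'m \<Rightarrow> 'm \<Rightarrow> 'm \<Rightarrow> bool" where
  "is_function f X Y \<longleftrightarrow>
     (\<forall>p. p \<epsilon> f \<longrightarrow> (\<exists>x y. x \<epsilon> X \<and> y \<epsilon> Y \<and> p = opair x y)) \<and>
     (\<forall>x. x \<epsilon> X \<longrightarrow> (\<exists>!y. opair x y \<epsilon> f))"

definition is_injection :: "'m \<Rightarrow> 'm \<Rightarrow> 'm \<Rightarrow> bool" where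
  "is_injection f X Y \<longleftrightarrow> is_function f X Y \<and>
     (\<forall>x x' y. opair x y \<epsilon> f \<and> opair x' y \<epsilon> f \<longrightarrow> x = x')"

definition is_bijection :: "'m \<Rightarrow> 'm \<Rightarrow> 'm \<Rightarrow> bool" where
  "is_bijection f X Y \<longleftrightarrow> is_injection f X Y \<and> (\<forall>y. y \<epsilon> Y \<longrightarrow> (\<exists>x. opair x y \<epsilon> f))"

definition injects_into :: "'m \<Rightarrow> 'm \<Rightarrow> bool" where
  "injects_into X Y \<longleftrightarrow> (\<exists>f. is_injection f X Y)"

definition is_finite :: "'m \<Rightarrow> bool" where
  "is_finite X \<longleftrightarrow> (\<exists>n f. n \<epsilon> omega \<and> is_bijection f X n)"

definition dedekind_infinite :: "'m \<Rightarrow> bool" where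
  "dedekind_infinite X \<longleftrightarrow> injects_into omega X"

definition power_dedekind_infinite :: "'m \<Rightarrow> bool" where
  "power_dedekind_infinite X \<longleftrightarrow> dedekind_infinite (pow X)"

definition is_partition :: "'m \<Rightarrow> 'm \<Rightarrow> bool" where
  "is_partition A P \<longleftrightarrow>
     (\<forall>x. x \<epsilon> P \<longrightarrow> x \<sqsubseteq> A \<and> (\<exists>a. a \<epsilon> x)) \<and>
     (\<forall>a. a \<epsilon> A \<longrightarrow> (\<exists>!x. x \<epsilon> P \<and> a \<epsilon> x))"

definition is_finitary_partition :: "'m \<Rightarrow> 'm \<Rightarrow> bool" where
  "is_finitary_partition A P \<longleftrightarrow> is_partition A P \<and> (\<forall>x. x \<epsilon> P \<longrightarrow> is_finite x)"

definition finitary_partitions :: "'m \<Rightarrow> 'm" where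
  "finitary_partitions A = coll (\<lambda>P. is_finitary_partition A P)"

definition ns :: "'m \<Rightarrow> 'm" where
  "ns P = coll (\<lambda>x. x \<epsilon> P \<and> (\<exists>a b. a \<epsilon> x \<and> b \<epsilon> x \<and> a \<noteq> b))"

end


section \<open>Models of ZF\<close>

locale ZF_model = set_structure mem
  for mem :: "'m \<Rightarrow> 'm \<Rightarrow> bool"  (infix "\<epsilon>" 50) +
  assumes extensionality: "\<forall>a b. (\<forall>x. x \<epsilon> a \<longleftrightarrow> x \<epsilon> b) \<longrightarrow> a = b"
    and foundation: "\<forall>a. (\<exists>x. x \<epsilon> a) \<longrightarrow> (\<exists>x. x \<epsilon> a \<and> (\<forall>y. y \<epsilon> x \<longrightarrow> \<not> y \<epsilon> a))"
    and pairing: "\<forall>a b. \<exists>c. \<forall>x. x \<epsilon> c \<longleftrightarrow> x = a \<or> x = b"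
    and union: "\<forall>a. \<exists>u. \<forall>x. x \<epsilon> u \<longleftrightarrow> (\<exists>y. y \<epsilon> a \<and> x \<epsilon> y)"
    and powerset: "\<forall>a. \<exists>p. \<forall>x. x \<epsilon> p \<longleftrightarrow> (\<forall>z. z \<epsilon> x \<longrightarrow> z \<epsilon> a)"
    and infinity: "\<exists>i. (\<exists>z. z \<epsilon> i \<and> (\<forall>x. \<not> x \<epsilon> z)) \<and>
          (\<forall>x. x \<epsilon> i \<longrightarrow> (\<exists>y. y \<epsilon> i \<and> (\<forall>w. w \<epsilon> y \<longleftrightarrow> w \<epsilon> x \<or> w = x)))"
    and separation: "\<forall>\<phi> e a. \<exists>b. \<forall>x. x \<epsilon> b \<longleftrightarrow> x \<epsilon> a \<and> sat mem \<phi> (case_nat x e)"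
    and replacement: "\<forall>\<phi> e a.
          (\<forall>x. x \<epsilon> a \<longrightarrow> (\<forall>y y'. sat mem \<phi> (case_nat x (case_nat y e)) \<and>
                               sat mem \<phi> (case_nat x (case_nat y' e)) \<longrightarrow> y = y')) \<longrightarrow>
          (\<exists>b. \<forall>y. y \<epsilon> b \<longleftrightarrow> (\<exists>x. x \<epsilon> a \<and> sat mem \<phi> (case_nat x (case_nat y e))))"


section \<open>The descriptions denote in models of ZF\<close>

definition definable :: "('m \<Rightarrow> 'm \<Rightarrow> bool) \<Rightarrow> ((nat \<Rightarrow> 'm) \<Rightarrow> bool) \<Rightarrow> bool" where
  "definable E Q \<longleftrightarrow> (\<exists>\<phi>. \<forall>e. sat E \<phi> e \<longleftrightarrow> Q e)"

context
  fixes E :: "'m \<Rightarrow> 'm \<Rightarrow> bool"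
begin

lemma definable_mem: "definable E (\<lambda>e. E (e i) (e j))"
  unfolding definable_def by (rule exI[of _ "FMem i j"]) simp

lemma definable_eq: "definable E (\<lambda>e. e i = e j)"
  unfolding definable_def by (rule exI[of _ "FEq i j"]) simp

lemma definable_not:
  assumes "definable E P"
  shows "definable E (\<lambda>e. \<not> P e)"
proof -
  obtain p where "\<And>e. sat E p e \<longleftrightarrow> P e"
    using assms unfolding definable_def by blast
  then show ?thesis
    unfolding definable_def by (intro exI[of _ "FNeg p"]) simp
qed

lemma definable_conj:
  assumes "definable E P" "definable E Q"
  shows "definable E (\<lambda>e. P e \<and> Q e)"
proof -
  obtain p q where "\<And>e. sat E p e \<longleftrightarrow> P e" "\<And>e. sat E q e \<longleftrightarrow> Q e"
    using assms unfolding definable_def by blast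
  then show ?thesis
    unfolding definable_def by (intro exI[of _ "FConj p q"]) simp
qed

lemma definable_disj:
  assumes "definable E P" "definable E Q"
  shows "definable E (\<lambda>e. P e \<or> Q e)"
  using definable_not[OF definable_conj[OF definable_not[OF assms(1)] definable_not[OF assms(2)]]]
  by simp

lemma definable_imp:
  assumes "definable E P" "definable E Q"
  shows "definable E (\<lambda>e. P e \<longrightarrow> Q e)"
  using definable_disj[OF definable_not[OF assms(1)] assms(2)] by simp

lemma definable_iff:
  assumes "definable E P" "definable E Q"
  shows "definable E (\<lambda>e. P e \<longleftrightarrow> Q e)"
  using definable_conj[OF definable_imp[OF assms] definable_imp[OF assms(2,1)]]
  by (simp only: iff_conv_conj_imp)

lemma definable_all:
  assumes "definable E (\<lambda>e. Q (e 0) (\<lambda>n. e (Suc n)))"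
  shows "definable E (\<lambda>e. \<forall>x. Q x e)"
proof -
  obtain \<phi> where "\<And>e. sat E \<phi> e \<longleftrightarrow> Q (e 0) (\<lambda>n. e (Suc n))"
    using assms unfolding definable_def by blast
  then show ?thesis
    unfolding definable_def by (intro exI[of _ "FAll \<phi>"]) simp
qed

lemma definable_ex:
  assumes "definable E (\<lambda>e. Q (e 0) (\<lambda>n. e (Suc n)))"
  shows "definable E (\<lambda>e. \<exists>x. Q x e)"
  using definable_not[OF definable_all[OF definable_not[OF assms]]] by simp

lemmas definable_intros = definable_mem definable_eq definable_not definable_conj definable_disj
  definable_imp definable_iff definable_all definable_ex

end

context ZF_model
begin

lemma mem_coll:
  assumes "\<exists>b. \<forall>x. x \<epsilon> b \<longleftrightarrow> P x"
  shows "x \<epsilon> coll P \<longleftrightarrow> P x"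
proof -
  obtain b where b: "\<forall>x. x \<epsilon> b \<longleftrightarrow> P x"
    using assms by blast
  have "coll P = b"
    unfolding coll_def
  proof (rule the_equality)
    fix c assume "\<forall>x. x \<epsilon> c \<longleftrightarrow> P x"
    with b show "c = b"
      by (intro extensionality[rule_format]) simp
  qed (rule b)
  with b show ?thesis by simp
qed

lemma definable_separation:
  assumes "definable mem (\<lambda>e. Q (e 0) (\<lambda>n. e (Suc n)))"
  shows "\<exists>b. \<forall>x. x \<epsilon> b \<longleftrightarrow> x \<epsilon> a \<and> Q x e"
proof -
  obtain \<phi> where "\<And>e. sat mem \<phi> e \<longleftrightarrow> Q (e 0) (\<lambda>n. e (Suc n))"
    using assms unfolding definable_def by blast
  then show ?thesis
    using separation[rule_format, of a \<phi> e] by simp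
qed

lemma mem_pow: "y \<epsilon> pow x \<longleftrightarrow> y \<sqsubseteq> x"
  unfolding pow_def using powerset by (intro mem_coll) (simp add: subset_of_def)

lemma mem_upair: "x \<epsilon> upair a b \<longleftrightarrow> x = a \<or> x = b"
  unfolding upair_def using pairing by (intro mem_coll) simp

lemma upair_eq_iff: "z = upair a b \<longleftrightarrow> (\<forall>x. x \<epsilon> z \<longleftrightarrow> x = a \<or> x = b)"
  using extensionality mem_upair by metis

lemma opair_inject: "opair a b = opair c d \<longleftrightarrow> a = c \<and> b = d"
  unfolding opair_def by (metis mem_upair)

lemma mem_empty: "\<not> x \<epsilon> emptyset"
proof -
  have "\<exists>b. \<forall>x. x \<epsilon> b \<longleftrightarrow> False" using infinity by blast
  from mem_coll[OF this] show ?thesis unfolding emptyset_def by blast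
qed

lemma mem_succ: "y \<epsilon> succ x \<longleftrightarrow> y \<epsilon> x \<or> y = x"
  unfolding succ_def
proof (rule mem_coll)
  obtain u where "\<And>y. y \<epsilon> u \<longleftrightarrow> (\<exists>z. z \<epsilon> upair x (upair x x) \<and> y \<epsilon> z)"
    using union by meson
  then show "\<exists>b. \<forall>y. y \<epsilon> b \<longleftrightarrow> y \<epsilon> x \<or> y = x"
    by (metis mem_upair)
qed

lemma empty_mem_iff: "emptyset \<epsilon> I \<longleftrightarrow> (\<exists>z. z \<epsilon> I \<and> (\<forall>x. \<not> x \<epsilon> z))"
  using extensionality mem_empty by metis

lemma succ_mem_iff: "succ x \<epsilon> I \<longleftrightarrow> (\<exists>s. s \<epsilon> I \<and> (\<forall>y. y \<epsilon> s \<longleftrightarrow> y \<epsilon> x \<or> y = x))"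
  using extensionality mem_succ by metis

lemma opair_mem_iff:
  "opair x y \<epsilon> f \<longleftrightarrow> (\<exists>p. p \<epsilon> f \<and> p = opair x y)"
  by blast

lemma eq_opair_iff:
  "p = opair x y \<longleftrightarrow> (\<forall>z. z \<epsilon> p \<longleftrightarrow>
     (\<forall>w. w \<epsilon> z \<longleftrightarrow> w = x \<or> w = x) \<or> (\<forall>w. w \<epsilon> z \<longleftrightarrow> w = x \<or> w = y))"
  unfolding opair_def upair_eq_iff[symmetric] by (rule refl)

lemma mem_omega: "n \<epsilon> omega \<longleftrightarrow> (\<forall>I. is_inductive I \<longrightarrow> n \<epsilon> I)"
  unfolding omega_def
proof (rule mem_coll)
  obtain J where J: "is_inductive J"
    using infinity unfolding is_inductive_def empty_mem_iff succ_mem_iff by blast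
  have "definable mem (\<lambda>e. \<forall>I. is_inductive I \<longrightarrow> e 0 \<epsilon> I)"
    unfolding is_inductive_def empty_mem_iff succ_mem_iff
    by (intro definable_intros[where E = mem])
  then have "\<exists>b. \<forall>n. n \<epsilon> b \<longleftrightarrow> n \<epsilon> J \<and> (\<forall>I. is_inductive I \<longrightarrow> n \<epsilon> I)"
    by (rule definable_separation[where Q = "\<lambda>n e. \<forall>I. is_inductive I \<longrightarrow> n \<epsilon> I"])
  then show "\<exists>b. \<forall>n. n \<epsilon> b \<longleftrightarrow> (\<forall>I. is_inductive I \<longrightarrow> n \<epsilon> I)"
    using J by blast
qed

lemma mem_finitary_partitions: "P \<epsilon> finitary_partitions A \<longleftrightarrow> is_finitary_partition A P"
  unfolding finitary_partitions_def
proof (rule mem_coll)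
  have "definable mem (\<lambda>e. is_finitary_partition (e 1) (e 0))"
    unfolding is_finitary_partition_def is_partition_def is_finite_def is_bijection_def
      is_injection_def is_function_def subset_of_def opair_mem_iff eq_opair_iff mem_omega
      is_inductive_def empty_mem_iff succ_mem_iff Ex1_def
    by (intro definable_intros[where E = mem])
  then have "\<exists>b. \<forall>P. P \<epsilon> b \<longleftrightarrow> P \<epsilon> pow (pow A) \<and> is_finitary_partition A P"
    using definable_separation[where Q = "\<lambda>P e. is_finitary_partition (e 0) P" and e = "\<lambda>_. A"]
    by simp
  moreover have "P \<epsilon> pow (pow A)" if "is_finitary_partition A P" for P
    using that unfolding is_finitary_partition_def is_partition_def mem_pow subset_of_def by blast
  ultimately show "\<exists>b. \<forall>P. P \<epsilon> b \<longleftrightarrow> is_finitary_partition A P"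
    by blast
qed

lemma mem_ns: "x \<epsilon> ns P \<longleftrightarrow> x \<epsilon> P \<and> (\<exists>a b. a \<epsilon> x \<and> b \<epsilon> x \<and> a \<noteq> b)"
  unfolding ns_def
proof (rule mem_coll)
  have "definable mem (\<lambda>e. \<exists>a b. a \<epsilon> e 0 \<and> b \<epsilon> e 0 \<and> a \<noteq> b)"
    by (intro definable_intros[where E = mem])
  then show "\<exists>c. \<forall>x. x \<epsilon> c \<longleftrightarrow> x \<epsilon> P \<and> (\<exists>a b. a \<epsilon> x \<and> b \<epsilon> x \<and> a \<noteq> b)"
    by (rule definable_separation[where Q = "\<lambda>x e. \<exists>a b. a \<epsilon> x \<and> b \<epsilon> x \<and> a \<noteq> b"])
qed

end

end

theory Submission
  imports Defs
begin

text \<open>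
  A set \<open>X\<close> is power Dedekind infinite iff there is an unbounded map \<open>X \<rightarrow> \<omega>\<close>. Indeed, suppose
  that all maps \<open>X \<rightarrow> \<omega>\<close> are bounded, and let \<open>F q : \<omega> \<rightarrow> \<omega>\<close>, for \<open>q \<in> X\<close>, be bounded sequences
  (for instance the indicators of membership in a sequence of subsets). Then the \<open>F q\<close> have a
  common bound, and some \<open>N\<close> is such that \<open>F q\<close> is determined by its restriction to \<open>N\<close>:
  otherwise some \<open>F p\<close> is not isolated among the \<open>F q\<close>, and the first place where \<open>F q\<close> differs from
  \<open>F p\<close> is an unbounded function of \<open>q\<close>. So there are only finitely many maps \<open>q \<mapsto> F q n\<close>.

  An unbounded map on \<open>ns P\<close> yields (iii) by splitting into singletons the blocks that are not
  selected by a subset of \<open>\<omega>\<close>. For (i) \<open>\<Longrightarrow>\<close> (ii), let \<open>G\<close> be a sequence of distinct finitary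
  partitions and consider the equivalence relation they generate. If it has an infinite class, this
  class is the union of a strictly increasing sequence of finite sets, whose successive differences
  (thinned out to have at least two elements) are blocks of a finitary partition. Otherwise its
  classes form a finitary partition \<open>Q\<close> refined by each \<open>G n\<close>; the restrictions of the \<open>G n\<close> to a
  block \<open>q\<close> of \<open>Q\<close> are finitely many, and the least \<open>m\<close> with \<open>G m\<close> equal to \<open>G n\<close> on \<open>q\<close> is a bounded
  sequence \<open>F q\<close> to which the first paragraph applies.
\<close>

section \<open>Renaming of variables, and environments with parameters\<close>

primrec rename :: "(nat \<Rightarrow> nat) \<Rightarrow> fm \<Rightarrow> fm" where
  "rename \<rho> (FMem i j) = FMem (\<rho> i) (\<rho> j)"
| "rename \<rho> (FEq i j) = FEq (\<rho> i) (\<rho> j)"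
| "rename \<rho> (FNeg p) = FNeg (rename \<rho> p)"
| "rename \<rho> (FConj p q) = FConj (rename \<rho> p) (rename \<rho> q)"
| "rename \<rho> (FAll p) = FAll (rename (case_nat 0 (\<lambda>n. Suc (\<rho> n))) p)"

text \<open>Renamings serve below to keep the variables of two formulas apart and to redirect
  coordinates that receive the same value. The quantifier case lifts \<open>\<rho>\<close>, so the
  induction needs it arbitrary.\<close>

lemma sat_rename: "sat E (rename \<rho> p) e \<longleftrightarrow> sat E p (\<lambda>n. e (\<rho> n))"
proof (induction p arbitrary: \<rho> e)
  case (FAll p)
  have "(\<lambda>n. case_nat x e (case_nat 0 (\<lambda>n. Suc (\<rho> n)) n)) = case_nat x (\<lambda>n. e (\<rho> n))" for x
    by (auto split: nat.split)
  then show ?case by (simp add: FAll.IH)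
qed auto

text \<open>Variables and parameters of a formula: \<open>sat\<close> is evaluated under an environment whose entries
  are either entries of a given environment or fixed elements of the structure.\<close>

definition coordinate :: "((nat \<Rightarrow> 'm) \<Rightarrow> 'm) \<Rightarrow> bool" where
  "coordinate g \<longleftrightarrow> (\<exists>i. g = (\<lambda>e. e i)) \<or> (\<exists>c. g = (\<lambda>e. c))"

lemma coordinateE:
  assumes "coordinate g"
  obtains i where "g = (\<lambda>e. e i)" | c where "g = (\<lambda>e. c)"
  using assms unfolding coordinate_def by blast

lemma coordinate_proj [simp]: "coordinate (\<lambda>e. e i)"
  and coordinate_const [simp]: "coordinate (\<lambda>e. c)"
  unfolding coordinate_def by blast+

lemma coordinate_case_nat [simp]:
  "coordinate g \<Longrightarrow> (\<And>n. coordinate (h n)) \<Longrightarrow> coordinate (case_nat g h n)"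
  by (cases n) simp_all

text \<open>A projection is constant only if there is a single element. This settles the overlap of
  the two kinds of coordinates in case distinctions on their shape.\<close>

lemma proj_eq_constD: "(\<lambda>e. e i) = (\<lambda>e. c) \<Longrightarrow> x = c"
  by (drule fun_cong[of _ _ "\<lambda>_. x"]) simp

lemma coordinate_subst: "coordinate g \<Longrightarrow> (\<And>n. coordinate (r n)) \<Longrightarrow> coordinate (\<lambda>e. g (\<lambda>n. r n e))"
  by (erule coordinateE) simp_all

lemma coordinate_push: "coordinate g \<Longrightarrow> coordinate (\<lambda>e. g (case_nat c e))"
proof (erule coordinateE)
  fix i assume "g = (\<lambda>e. e i)"
  then show ?thesis by (cases i) simp_all
qed simp

context ZF_model
begin

section \<open>Definability with parameters\<close>

text \<open>Unlike \<open>definable\<close>, this admits elements of the structure as parameters, in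
  the form of constant coordinates. Predicates and maps of HOL enter separation, replacement and
  induction only under this condition or its analogue \<open>defterm\<close> for terms.\<close>

definition defpred :: "((nat \<Rightarrow> 'm) \<Rightarrow> bool) \<Rightarrow> bool" where
  "defpred Q \<longleftrightarrow> (\<exists>\<phi> g. (\<forall>n. coordinate (g n)) \<and> (\<forall>e. Q e \<longleftrightarrow> sat mem \<phi> (\<lambda>n. g n e)))"

definition defterm :: "((nat \<Rightarrow> 'm) \<Rightarrow> 'm) \<Rightarrow> bool" where
  "defterm t \<longleftrightarrow> defpred (\<lambda>e. e 0 = t (\<lambda>n. e (Suc n)))"

lemma defpredI: "(\<And>n. coordinate (g n)) \<Longrightarrow> (\<And>e. Q e \<longleftrightarrow> sat mem \<phi> (\<lambda>n. g n e)) \<Longrightarrow> defpred Q"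
  unfolding defpred_def by blast

lemma defpredE:
  assumes "defpred Q"
  obtains \<phi> g where "\<And>n. coordinate (g n)" "\<And>e. Q e \<longleftrightarrow> sat mem \<phi> (\<lambda>n. g n e)"
  using assms unfolding defpred_def by blast

lemma defpred_subst:
  assumes "defpred Q" "\<And>n. coordinate (r n)"
  shows "defpred (\<lambda>e. Q (\<lambda>n. r n e))"
proof -
  obtain \<phi> g where g: "\<And>n. coordinate (g n)" "\<And>e. Q e \<longleftrightarrow> sat mem \<phi> (\<lambda>n. g n e)"
    using assms(1) by (rule defpredE) blast
  show ?thesis
    by (rule defpredI[where \<phi> = \<phi> and g = "\<lambda>n e. g n (\<lambda>m. r m e)"])
      (auto simp: g(2) intro: coordinate_subst g(1) assms(2))
qed

lemma defpred_mem0: "defpred (\<lambda>e. e i \<epsilon> e j)"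
  by (rule defpredI[where \<phi> = "FMem i j" and g = "\<lambda>n e. e n"]) simp_all

lemma defpred_eq0: "defpred (\<lambda>e. e i = e j)"
  by (rule defpredI[where \<phi> = "FEq i j" and g = "\<lambda>n e. e n"]) simp_all

lemma defpred_not [simp]: assumes "defpred P" shows "defpred (\<lambda>e. \<not> P e)"
proof -
  obtain \<phi> g where g: "\<And>n. coordinate (g n)" "\<And>e. P e \<longleftrightarrow> sat mem \<phi> (\<lambda>n. g n e)"
    using assms by (rule defpredE) blast
  show ?thesis by (rule defpredI[where \<phi> = "FNeg \<phi>" and g = g]) (simp_all add: g)
qed

lemma defpred_conj [simp]:
  assumes "defpred P" "defpred Q" shows "defpred (\<lambda>e. P e \<and> Q e)"
proof -
  obtain \<phi> g where g: "\<And>n. coordinate (g n)" "\<And>e. P e \<longleftrightarrow> sat mem \<phi> (\<lambda>n. g n e)"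
    using assms(1) by (rule defpredE) blast
  obtain \<psi> h where h: "\<And>n. coordinate (h n)" "\<And>e. Q e \<longleftrightarrow> sat mem \<psi> (\<lambda>n. h n e)"
    using assms(2) by (rule defpredE) blast
  \<comment> \<open>Even indices of the combined environment carry the coordinates of
    \<open>\<phi>\<close>, odd ones those of \<open>\<psi>\<close>.\<close>
  show ?thesis
    by (rule defpredI[where \<phi> = "FConj (rename (\<lambda>n. 2 * n) \<phi>) (rename (\<lambda>n. Suc (2 * n)) \<psi>)"
          and g = "\<lambda>n. if even n then g (n div 2) else h (n div 2)"])
      (simp_all add: g h sat_rename)
qed

lemma defpred_disj [simp]: "defpred P \<Longrightarrow> defpred Q \<Longrightarrow> defpred (\<lambda>e. P e \<or> Q e)"
  using defpred_not[OF defpred_conj[OF defpred_not defpred_not], of P Q] by simp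

lemma defpred_imp [simp]: "defpred P \<Longrightarrow> defpred Q \<Longrightarrow> defpred (\<lambda>e. P e \<longrightarrow> Q e)"
  using defpred_disj[OF defpred_not, of P Q] by (simp only: imp_conv_disj)

lemma defpred_iff [simp]: "defpred P \<Longrightarrow> defpred Q \<Longrightarrow> defpred (\<lambda>e. P e \<longleftrightarrow> Q e)"
  using defpred_conj[OF defpred_imp defpred_imp, of P Q Q P] by (simp only: iff_conv_conj_imp)

lemma defpred_all [simp]:
  assumes "defpred (\<lambda>e. Q (e 0) (\<lambda>n. e (Suc n)))"
  shows "defpred (\<lambda>e. \<forall>x. Q x e)"
proof -
  obtain \<phi> g where g: "\<And>n. coordinate (g n)"
    "\<And>e. Q (e 0) (\<lambda>n. e (Suc n)) \<longleftrightarrow> sat mem \<phi> (\<lambda>n. g n e)"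
    using assms by (rule defpredE) blast
  \<comment> \<open>Coordinates that read the bound variable are sent to index 0, where
    \<open>FAll\<close> puts its value. All others do not depend on entry 0 of the environment, so
    \<open>undefined\<close> may stand there.\<close>
  define \<rho> where "\<rho> n = (if g n = (\<lambda>e. e 0) then 0 else Suc n)" for n
  have env: "case_nat x (\<lambda>n. g n (case_nat undefined e)) (\<rho> n) = g n (case_nat x e)" for x e n
    using g(1)[of n] unfolding \<rho>_def by (auto elim!: coordinateE split: nat.split)
  have co: "coordinate (\<lambda>e. g n (case_nat undefined e))" for n
    using g(1) by (rule coordinate_push)
  have "Q x e \<longleftrightarrow> sat mem \<phi> (\<lambda>n. g n (case_nat x e))" for x e
    using g(2)[of "case_nat x e"] by simp
  then show ?thesis
    by (intro defpredI[where \<phi> = "FAll (rename \<rho> \<phi>)" and g = "\<lambda>n e. g n (case_nat undefined e)"])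
      (simp_all add: co sat_rename env)
qed

lemma defpred_ex [simp]:
  assumes "defpred (\<lambda>e. Q (e 0) (\<lambda>n. e (Suc n)))"
  shows "defpred (\<lambda>e. \<exists>x. Q x e)"
  using defpred_not[OF defpred_all[OF defpred_not[OF assms]]] by simp

lemma defpred_const: "defpred (\<lambda>e. c)"
  using defpred_disj[OF defpred_eq0[of 0 0] defpred_not[OF defpred_eq0[of 0 0]]] defpred_not[OF defpred_eq0[of 0 0]]
  by (cases c) auto

lemma defterm_var [simp]: "defterm (\<lambda>e. e i)"
  unfolding defterm_def by (rule defpred_eq0)

lemma defterm_const [simp]: "defterm (\<lambda>e. c)"
  unfolding defterm_def
  using defpred_subst[OF defpred_eq0[of 0 1], of "\<lambda>n. if n = 0 then (\<lambda>e. e 0) else (\<lambda>e. c)"] by simp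

lemma defterm_shift: "defterm t \<Longrightarrow> defterm (\<lambda>e. t (\<lambda>n. e (Suc n)))"
  unfolding defterm_def
  using defpred_subst[of "\<lambda>e. e 0 = t (\<lambda>n. e (Suc n))" "case_nat (\<lambda>e. e 0) (\<lambda>n e. e (Suc (Suc n)))"]
  by (auto split: nat.split)

text \<open>The term is eliminated in favour of its graph: \<open>Q (s e) e\<close> is equivalent to
  \<open>\<exists>x. x = s e \<and> Q x e\<close>.\<close>

lemma defpred_sub:
  assumes "defpred (\<lambda>e. Q (e 0) (\<lambda>n. e (Suc n)))" "defterm s"
  shows "defpred (\<lambda>e. Q (s e) e)"
  using defpred_ex[where Q = "\<lambda>x e. x = s e \<and> Q x e"] assms unfolding defterm_def by simp

lemma defpred_sub1: "defpred (\<lambda>e. Q (e 0)) \<Longrightarrow> defterm s \<Longrightarrow> defpred (\<lambda>e. Q (s e))"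
  using defpred_sub[where Q = "\<lambda>x e. Q x"] by simp

lemma defpred_sub2:
  assumes "defpred (\<lambda>e. Q (e 0) (e 1))" "defterm s" "defterm t"
  shows "defpred (\<lambda>e. Q (s e) (t e))"
proof -
  have "defpred (\<lambda>e. Q (e 1) (e 0))"
    using defpred_subst[OF assms(1), of "\<lambda>n. if n = 0 then (\<lambda>e. e 1) else (\<lambda>e. e 0)"] by simp
  from defpred_sub[where Q = "\<lambda>y e. Q (e 0) y", OF _ defterm_shift[OF assms(3)]] this
  have "defpred (\<lambda>e. Q (e 0) (t (\<lambda>n. e (Suc n))))" by simp
  from defpred_sub[where Q = "\<lambda>x e. Q x (t e)", OF this assms(2)] show ?thesis by simp
qed

lemma defpred_sub3:
  assumes "defpred (\<lambda>e. Q (e 0) (e 1) (e 2))" "defterm s" "defterm t" "defterm u"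
  shows "defpred (\<lambda>e. Q (s e) (t e) (u e))"
proof -
  have *: "defpred (\<lambda>e. Q (e 2) (e 1) (e 0))"
    using defpred_subst[OF assms(1), of "\<lambda>n. if n = 0 then (\<lambda>e. e 2) else if n = 1 then (\<lambda>e. e 1) else (\<lambda>e. e 0)"]
    by simp
  have "defpred (\<lambda>e. \<exists>x. x = s e \<and> (\<exists>y. y = t e \<and> (\<exists>z. z = u e \<and> Q x y z)))"
    using * assms(2) defterm_shift[OF assms(3)] defterm_shift[OF defterm_shift[OF assms(4)]]
    by (intro defpred_ex defpred_conj) (simp_all add: defterm_def numeral_2_eq_2)
  then show ?thesis by simp
qed

lemma defterm_fun1:
  assumes "defterm (\<lambda>e. F (e 0))" "defterm s" shows "defterm (\<lambda>e. F (s e))"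
proof -
  have "defpred (\<lambda>e. e 0 = F (e 1))" using assms(1) by (simp add: defterm_def)
  from defpred_sub2[where Q = "\<lambda>a b. a = F b", OF this defterm_var[of 0] defterm_shift[OF assms(2)]]
  show ?thesis by (subst defterm_def)
qed

lemma defterm_fun2:
  assumes "defterm (\<lambda>e. F (e 0) (e 1))" "defterm s" "defterm t" shows "defterm (\<lambda>e. F (s e) (t e))"
proof -
  have "defpred (\<lambda>e. e 0 = F (e 1) (e 2))" using assms(1) by (simp add: defterm_def numeral_2_eq_2)
  from defpred_sub3[where Q = "\<lambda>a b c. a = F b c", OF this defterm_var[of 0] defterm_shift[OF assms(2)] defterm_shift[OF assms(3)]]
  show ?thesis by (subst defterm_def)
qed

lemma defpred_mem [simp]: "defterm s \<Longrightarrow> defterm t \<Longrightarrow> defpred (\<lambda>e. s e \<epsilon> t e)"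
  using defpred_sub2[where Q = mem, OF defpred_mem0] .

lemma defpred_eq [simp]: "defterm s \<Longrightarrow> defterm t \<Longrightarrow> defpred (\<lambda>e. s e = t e)"
  using defpred_sub2[where Q = "(=)", OF defpred_eq0] .

lemma defterm_if [simp]: "defpred P \<Longrightarrow> defterm s \<Longrightarrow> defterm t \<Longrightarrow> defterm (\<lambda>e. if P e then s e else t e)"
proof -
  assume a: "defpred P" "defterm s" "defterm t"
  have "defpred (\<lambda>e. P (\<lambda>n. e (Suc n)))"
    using defpred_subst[OF a(1), of "\<lambda>n e. e (Suc n)"] by simp
  then have "defpred (\<lambda>e. P (\<lambda>n. e (Suc n)) \<and> e 0 = s (\<lambda>n. e (Suc n)) \<or>
      \<not> P (\<lambda>n. e (Suc n)) \<and> e 0 = t (\<lambda>n. e (Suc n)))"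
    using a(2,3) unfolding defterm_def by (intro defpred_disj defpred_conj defpred_not)
  then show ?thesis
    unfolding defterm_def by (rule back_subst[where P = defpred]) auto
qed

text \<open>For a collection that exists, \<open>b = coll P\<close> unfolds by extensionality to
  \<open>\<forall>x. x \<epsilon> b \<longleftrightarrow> P x\<close>, which is a formula. Existence
  is required in every environment because \<open>coll\<close> is unspecified otherwise.\<close>

lemma defterm_coll:
  assumes "\<And>e. \<exists>b. \<forall>x. x \<epsilon> b \<longleftrightarrow> Q x e" "defpred (\<lambda>e. Q (e 0) (\<lambda>n. e (Suc n)))"
  shows "defterm (\<lambda>e. coll (\<lambda>x. Q x e))"
proof -
  have "b = coll (\<lambda>x. Q x e) \<longleftrightarrow> (\<forall>x. x \<epsilon> b \<longleftrightarrow> Q x e)" for b e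
    using mem_coll[OF assms(1)[of e]] extensionality by metis
  moreover have "defpred (\<lambda>e. Q (e 0) (\<lambda>n. e (Suc (Suc n))))"
    using defpred_subst[OF assms(2), of "case_nat (\<lambda>e. e 0) (\<lambda>n e. e (Suc (Suc n)))"] by simp
  ultimately have "defpred (\<lambda>e. e 0 = coll (\<lambda>x. Q x (\<lambda>n. e (Suc n))))" by simp
  then show ?thesis by (subst defterm_def)
qed

lemma separation_defpred:
  assumes "defpred (\<lambda>e. Q (e 0))"
  shows "\<exists>b. \<forall>x. x \<epsilon> b \<longleftrightarrow> x \<epsilon> a \<and> Q x"
proof -
  obtain \<phi> g where g: "\<And>n. coordinate (g n)" "\<And>e. Q (e 0) \<longleftrightarrow> sat mem \<phi> (\<lambda>n. g n e)"
    using assms by (rule defpredE) blast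
  \<comment> \<open>As only \<open>e 0\<close> matters, the formula is evaluated in the environment
    with all entries equal to \<open>x\<close>. There every projection has the value
    \<open>x\<close>, so all of them go to index 0; the constants become parameters.\<close>
  define \<rho> where "\<rho> n = (if \<exists>i. g n = (\<lambda>e. e i) then 0 else Suc n)" for n
  have "case_nat x (\<lambda>n. g n (\<lambda>_. undefined)) (\<rho> n) = g n (\<lambda>_. x)" for x n
    using g(1)[of n] unfolding \<rho>_def by (auto elim!: coordinateE dest: proj_eq_constD)
  then have "Q x \<longleftrightarrow> sat mem (rename \<rho> \<phi>) (case_nat x (\<lambda>n. g n (\<lambda>_. undefined)))" for x
    using g(2)[of "\<lambda>_. x"] by (simp add: sat_rename)
  then show ?thesis using separation by simp
qed

lemma replacement_defpred:
  assumes "defpred (\<lambda>e. R (e 0) (e 1))" and fn: "\<And>x y y'. x \<epsilon> a \<Longrightarrow> R x y \<Longrightarrow> R x y' \<Longrightarrow> y = y'"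
  shows "\<exists>b. \<forall>y. y \<epsilon> b \<longleftrightarrow> (\<exists>x. x \<epsilon> a \<and> R x y)"
proof -
  obtain \<phi> g where g: "\<And>n. coordinate (g n)" "\<And>e. R (e 0) (e 1) \<longleftrightarrow> sat mem \<phi> (\<lambda>n. g n e)"
    using assms(1) by (rule defpredE) blast
  \<comment> \<open>The environment used here has \<open>x\<close> at index 0 and \<open>y\<close>
    everywhere else, so all projections other than the first are identified with index 1.\<close>
  define \<rho> where "\<rho> n = (if g n = (\<lambda>e. e 0) then 0 else
      if \<exists>i. g n = (\<lambda>e. e i) then 1 else Suc (Suc n))" for n
  let ?e = "\<lambda>x y. case_nat x (case_nat y (\<lambda>n. g n (\<lambda>_. undefined)))"
  have "?e x y (\<rho> n) = g n (case_nat x (\<lambda>_. y))" for x y n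
  proof (cases "\<exists>i. g n = (\<lambda>e. e i)")
    case True
    then obtain i where i: "g n = (\<lambda>e. e i)" by blast
    show ?thesis
    proof (cases "g n = (\<lambda>e. e 0)")
      case False
      with i obtain j where "i = Suc j" by (cases i) auto
      with i False show ?thesis unfolding \<rho>_def by auto
    qed (simp add: \<rho>_def)
  next
    case False
    with g(1)[of n] obtain c where "g n = (\<lambda>e. c)" by (auto elim: coordinateE)
    moreover have "\<rho> n = Suc (Suc n)" using False unfolding \<rho>_def by auto
    ultimately show ?thesis by simp
  qed
  then have *: "R x y \<longleftrightarrow> sat mem (rename \<rho> \<phi>) (?e x y)" for x y
    using g(2)[of "case_nat x (\<lambda>_. y)"] by (simp add: sat_rename)
  have "\<exists>b. \<forall>y. y \<epsilon> b \<longleftrightarrow> (\<exists>x. x \<epsilon> a \<and> sat mem (rename \<rho> \<phi>) (?e x y))"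
    by (rule replacement[rule_format, of a "rename \<rho> \<phi>" "\<lambda>n. g n (\<lambda>_. undefined)"])
      (simp only: *[symmetric], blast intro: fn)
  then show ?thesis by (simp only: *)
qed

lemma defpred_ex1 [simp]:
  assumes "defpred (\<lambda>e. Q (e 0) (\<lambda>n. e (Suc n)))"
  shows "defpred (\<lambda>e. \<exists>!x. Q x e)"
proof -
  have "defpred (\<lambda>e. Q (e 0) (\<lambda>n. e (Suc (Suc n))))"
    using defpred_subst[OF assms, of "case_nat (\<lambda>e. e 0) (\<lambda>n e. e (Suc (Suc n)))"] by simp
  then show ?thesis using assms unfolding Ex1_def by simp
qed

section \<open>Set-building operations and their definability\<close>

lemma ext_iff: "a = b \<longleftrightarrow> (\<forall>x. x \<epsilon> a \<longleftrightarrow> x \<epsilon> b)"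
  using extensionality by blast

lemma setI: "(\<And>x. x \<epsilon> a \<longleftrightarrow> x \<epsilon> b) \<Longrightarrow> a = b"
  using extensionality by blast

definition Union :: "'m \<Rightarrow> 'm" where "Union a = coll (\<lambda>z. \<exists>y. y \<epsilon> a \<and> z \<epsilon> y)"
definition join :: "'m \<Rightarrow> 'm \<Rightarrow> 'm" where "join a b = Union (upair a b)"
definition adj :: "'m \<Rightarrow> 'm \<Rightarrow> 'm" where "adj x a = join (upair x x) a"
definition sep :: "'m \<Rightarrow> ('m \<Rightarrow> bool) \<Rightarrow> 'm" where "sep a Q = coll (\<lambda>x. x \<epsilon> a \<and> Q x)"
definition img :: "('m \<Rightarrow> 'm) \<Rightarrow> 'm \<Rightarrow> 'm" where "img F a = coll (\<lambda>y. \<exists>x. x \<epsilon> a \<and> y = F x)"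
text \<open>Unlike \<open>THE\<close>, whose value on a predicate without a unique witness depends on the predicate,
  this description operator is definable.\<close>

definition the1 :: "('m \<Rightarrow> bool) \<Rightarrow> 'm" where
  "the1 Q = (if \<exists>!y. Q y then THE y. Q y else emptyset)"
definition app :: "'m \<Rightarrow> 'm \<Rightarrow> 'm" where "app f x = the1 (\<lambda>y. opair x y \<epsilon> f)"

lemma mem_Union: "z \<epsilon> Union a \<longleftrightarrow> (\<exists>y. y \<epsilon> a \<and> z \<epsilon> y)"
  unfolding Union_def using union by (intro mem_coll) simp

lemma mem_join: "z \<epsilon> join a b \<longleftrightarrow> z \<epsilon> a \<or> z \<epsilon> b"
  unfolding join_def by (auto simp: mem_Union mem_upair)

lemma mem_adj: "z \<epsilon> adj x a \<longleftrightarrow> z = x \<or> z \<epsilon> a"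
  unfolding adj_def by (auto simp: mem_join mem_upair)

lemma mem_sep: "defpred (\<lambda>e. Q (e 0)) \<Longrightarrow> z \<epsilon> sep a Q \<longleftrightarrow> z \<epsilon> a \<and> Q z"
  unfolding sep_def by (intro mem_coll separation_defpred)

lemma ex_img:
  assumes "defterm (\<lambda>e. F (e 0))"
  shows "\<exists>b. \<forall>y. y \<epsilon> b \<longleftrightarrow> (\<exists>x. x \<epsilon> a \<and> y = F x)"
  using defpred_eq[OF defterm_var defterm_fun1[OF assms defterm_var]] by (intro replacement_defpred) auto

lemma mem_img: "defterm (\<lambda>e. F (e 0)) \<Longrightarrow> y \<epsilon> img F a \<longleftrightarrow> (\<exists>x. x \<epsilon> a \<and> y = F x)"
  unfolding img_def by (intro mem_coll ex_img)

lemma the1_eq: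
  assumes "Q y" "\<And>z. Q z \<Longrightarrow> z = y" shows "the1 Q = y"
proof -
  have "\<exists>!y. Q y" using assms by (rule ex1I)
  moreover have "(THE y. Q y) = y" using assms by (rule the_equality)
  ultimately show ?thesis by (simp only: the1_def if_True)
qed

text \<open>The entries of the environment that are fixed to \<open>c\<close> turn into
  parameters.\<close>

lemma defterm_instance:
  assumes "defterm (\<lambda>e. F (e 0) (\<lambda>n. e (Suc n)))"
  shows "defterm (\<lambda>e. F (e 0) c)"
  using defpred_subst[OF assms[unfolded defterm_def], of "case_nat (\<lambda>e. e 0) (case_nat (\<lambda>e. e 1) (\<lambda>n e. c n))"]
  unfolding defterm_def by simp

lemma defpred_instance:
  assumes "defpred (\<lambda>e. Q (e 0) (\<lambda>n. e (Suc n)))"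
  shows "defpred (\<lambda>e. Q (e 0) c)"
  using defpred_subst[OF assms, of "case_nat (\<lambda>e. e 0) (\<lambda>n e. c n)"] by simp

lemma defterm_the1 [simp]:
  assumes "defpred (\<lambda>e. Q (e 0) (\<lambda>n. e (Suc n)))"
  shows "defterm (\<lambda>e. the1 (\<lambda>y. Q y e))"
proof -
  have eq: "z = the1 Q \<longleftrightarrow> Q z \<and> (\<forall>y. Q y \<longrightarrow> y = z) \<or> \<not> (\<exists>!y. Q y) \<and> z = emptyset" for z Q
  proof (cases "\<exists>!y. Q y")
    case True
    then obtain y where y: "Q y" "\<And>z. Q z \<Longrightarrow> z = y" by blast
    then have "the1 Q = y" by (intro the1_eq)
    with y show ?thesis by blast
  qed (auto simp: the1_def)
  have *: "defpred (\<lambda>e. Q (e i) (\<lambda>n. e (Suc (n + k))))" for i k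
    using defpred_subst[OF assms, of "case_nat (\<lambda>e. e i) (\<lambda>n e. e (Suc (n + k)))"] by simp
  show ?thesis
    unfolding defterm_def eq using *[of 0 0] *[of 0 1] by (intro defpred_disj defpred_conj defpred_all defpred_imp defpred_not defpred_ex1 defpred_eq) simp_all
qed

lemma defterm_upair [simp]: "defterm s \<Longrightarrow> defterm t \<Longrightarrow> defterm (\<lambda>e. upair (s e) (t e))"
  by (rule defterm_fun2, subst upair_def, rule defterm_coll) (simp_all add: pairing)

lemma defterm_opair [simp]: "defterm s \<Longrightarrow> defterm t \<Longrightarrow> defterm (\<lambda>e. opair (s e) (t e))"
  unfolding opair_def by simp

lemma defterm_Union [simp]: "defterm s \<Longrightarrow> defterm (\<lambda>e. Union (s e))"
  by (rule defterm_fun1, subst Union_def, rule defterm_coll) (simp_all add: union)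

lemma defterm_join [simp]: "defterm s \<Longrightarrow> defterm t \<Longrightarrow> defterm (\<lambda>e. join (s e) (t e))"
  unfolding join_def by simp

lemma defterm_adj [simp]: "defterm s \<Longrightarrow> defterm t \<Longrightarrow> defterm (\<lambda>e. adj (s e) (t e))"
  unfolding adj_def by simp

lemma succ_eq: "succ x = adj x x"
  by (rule setI) (auto simp: mem_succ mem_adj)

lemma defterm_succ [simp]: "defterm s \<Longrightarrow> defterm (\<lambda>e. succ (s e))"
  unfolding succ_eq by simp

lemma defpred_subset [simp]: "defterm s \<Longrightarrow> defterm t \<Longrightarrow> defpred (\<lambda>e. s e \<sqsubseteq> t e)"
  by (rule defpred_sub2) (simp_all add: subset_of_def)

lemma defterm_pow [simp]: "defterm s \<Longrightarrow> defterm (\<lambda>e. pow (s e))"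
  by (rule defterm_fun1, subst pow_def, rule defterm_coll) (use powerset in \<open>simp_all add: subset_of_def\<close>)

lemma defterm_sep [simp]:
  assumes "defterm a" "defpred (\<lambda>e. Q (e 0) (\<lambda>n. e (Suc n)))"
  shows "defterm (\<lambda>e. sep (a e) (\<lambda>x. Q x e))"
  unfolding sep_def
  by (rule defterm_coll) (use separation_defpred defpred_instance[OF assms(2)] defterm_shift[OF assms(1)] assms(2) in simp_all)

lemma defterm_img [simp]:
  assumes "defterm a" "defterm (\<lambda>e. F (e 0) (\<lambda>n. e (Suc n)))"
  shows "defterm (\<lambda>e. img (\<lambda>x. F x e) (a e))"
  unfolding img_def
proof (rule defterm_coll)
  show "\<exists>b. \<forall>y. y \<epsilon> b \<longleftrightarrow> (\<exists>x. x \<epsilon> a e \<and> y = F x e)" for e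
    by (rule ex_img[OF defterm_instance[OF assms(2)]])
  have "defterm (\<lambda>e. F (e 0) (\<lambda>n. e (Suc (Suc n))))"
    using defpred_subst[OF assms(2)[unfolded defterm_def], of "case_nat (\<lambda>e. e 0) (case_nat (\<lambda>e. e 1) (\<lambda>n e. e (Suc (Suc (Suc n)))))"]
    unfolding defterm_def by simp
  then show "defpred (\<lambda>e. \<exists>x. x \<epsilon> a (\<lambda>n. e (Suc n)) \<and> e 0 = F x (\<lambda>n. e (Suc n)))"
    using defterm_shift[OF defterm_shift[OF assms(1)]] by simp
qed

lemma defterm_app [simp]: "defterm s \<Longrightarrow> defterm t \<Longrightarrow> defterm (\<lambda>e. app (s e) (t e))"
  by (rule defterm_fun2) (simp_all add: app_def)

lemma defpred_is_finite [simp]: "defterm s \<Longrightarrow> defpred (\<lambda>e. is_finite (s e))"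
  by (rule defpred_sub1) (simp_all add: is_finite_def is_bijection_def is_injection_def is_function_def)

section \<open>Functions\<close>

lemma app_mem:
  assumes "is_function f X Y" "x \<epsilon> X"
  shows "app f x \<epsilon> Y" "opair x (app f x) \<epsilon> f" "opair x y \<epsilon> f \<longleftrightarrow> y = app f x"
proof -
  obtain y where y: "opair x y \<epsilon> f" "\<And>z. opair x z \<epsilon> f \<Longrightarrow> z = y"
    using assms unfolding is_function_def by blast
  then have a: "app f x = y" unfolding app_def by (intro the1_eq)
  show "app f x \<epsilon> Y"
    using y(1) assms(1) unfolding a is_function_def by (metis opair_inject)
  show "opair x (app f x) \<epsilon> f" unfolding a by (rule y(1))
  show "opair x y \<epsilon> f \<longleftrightarrow> y = app f x" for y unfolding a using y by blast
qed

definition lam :: "('m \<Rightarrow> 'm) \<Rightarrow> 'm \<Rightarrow> 'm" where "lam F X = img (\<lambda>x. opair x (F x)) X"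

lemma mem_lam: "defterm (\<lambda>e. F (e 0)) \<Longrightarrow> opair x y \<epsilon> lam F X \<longleftrightarrow> x \<epsilon> X \<and> y = F x"
  unfolding lam_def by (subst mem_img) (auto simp: opair_inject)

lemma lam_function:
  assumes "defterm (\<lambda>e. F (e 0))" "\<And>x. x \<epsilon> X \<Longrightarrow> F x \<epsilon> Y"
  shows "is_function (lam F X) X Y"
proof -
  have "\<exists>x y. x \<epsilon> X \<and> y \<epsilon> Y \<and> p = opair x y" if "p \<epsilon> lam F X" for p
    using that assms unfolding lam_def by (subst (asm) mem_img) auto
  then show ?thesis unfolding is_function_def using assms by (simp add: mem_lam)
qed

lemma lam_injection:
  assumes "defterm (\<lambda>e. F (e 0))" "\<And>x. x \<epsilon> X \<Longrightarrow> F x \<epsilon> Y"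
    and "\<And>x x'. x \<epsilon> X \<Longrightarrow> x' \<epsilon> X \<Longrightarrow> F x = F x' \<Longrightarrow> x = x'"
  shows "is_injection (lam F X) X Y"
  unfolding is_injection_def using lam_function[OF assms(1,2)] assms(3) by (auto simp: mem_lam assms(1))

lemma injects_intoI:
  assumes "defterm (\<lambda>e. F (e 0))" "\<And>x. x \<epsilon> X \<Longrightarrow> F x \<epsilon> Y"
    and "\<And>x x'. x \<epsilon> X \<Longrightarrow> x' \<epsilon> X \<Longrightarrow> F x = F x' \<Longrightarrow> x = x'"
  shows "injects_into X Y"
  unfolding injects_into_def using lam_injection[OF assms] by blast

text \<open>An internal injection \<open>f\<close> becomes the HOL map \<open>app f\<close>, a
  definable term with parameter \<open>f\<close>. From here on sequences are such maps rather than
  sets of pairs.\<close>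

lemma injects_intoE:
  assumes "injects_into X Y"
  obtains F where "defterm (\<lambda>e. F (e 0))" "\<And>x. x \<epsilon> X \<Longrightarrow> F x \<epsilon> Y"
    "\<And>x x'. x \<epsilon> X \<Longrightarrow> x' \<epsilon> X \<Longrightarrow> F x = F x' \<Longrightarrow> x = x'"
proof -
  obtain f where f: "is_injection f X Y" using assms unfolding injects_into_def by blast
  then have "is_function f X Y" unfolding is_injection_def by blast
  note a = app_mem[OF this]
  have "x = x'" if "x \<epsilon> X" "x' \<epsilon> X" "app f x = app f x'" for x x'
    using f a(2)[OF that(1)] a(2)[OF that(2)] that(3) unfolding is_injection_def by metis
  then show ?thesis using a(1) by (intro that[of "app f"]) simp_all
qed

section \<open>Natural numbers\<close>

lemma zero_omega [simp]: "emptyset \<epsilon> omega"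
  unfolding mem_omega is_inductive_def by blast

lemma succ_omega [simp]: "n \<epsilon> omega \<Longrightarrow> succ n \<epsilon> omega"
  unfolding mem_omega is_inductive_def by blast

text \<open>The elements of \<open>omega\<close> satisfying \<open>Q\<close> form an inductive set,
  provided that separation yields this set. For arbitrary HOL predicates induction can fail, since
  \<open>omega\<close> may contain nonstandard numbers.\<close>

lemma omega_induct [consumes 1, case_names zero succ defpred]:
  assumes "n \<epsilon> omega" "Q emptyset" "\<And>n. n \<epsilon> omega \<Longrightarrow> Q n \<Longrightarrow> Q (succ n)"
    and "defpred (\<lambda>e. Q (e 0))"
  shows "Q n"
proof -
  have "is_inductive (sep omega Q)"
    unfolding is_inductive_def using assms by (simp add: mem_sep)
  then have "n \<epsilon> sep omega Q" using assms(1) unfolding mem_omega by blast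
  then show ?thesis using assms(4) by (simp add: mem_sep)
qed

lemma omega_cases:
  assumes "n \<epsilon> omega"
  obtains "n = emptyset" | m where "m \<epsilon> omega" "n = succ m"
proof -
  from assms have "n = emptyset \<or> (\<exists>m. m \<epsilon> omega \<and> n = succ m)"
    by (induction rule: omega_induct) auto
  then show ?thesis using that by blast
qed

lemma mem_irrefl: "\<not> x \<epsilon> x"
proof
  assume "x \<epsilon> x"
  obtain y where "y \<epsilon> upair x x" "\<And>z. z \<epsilon> y \<Longrightarrow> \<not> z \<epsilon> upair x x"
    using foundation[rule_format, of "upair x x"] mem_upair by blast
  then show False using \<open>x \<epsilon> x\<close> by (auto simp: mem_upair)
qed

lemma mem_asym: "x \<epsilon> y \<Longrightarrow> \<not> y \<epsilon> x"
proof
  assume "x \<epsilon> y" "y \<epsilon> x"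
  obtain z where "z \<epsilon> upair x y" "\<And>w. w \<epsilon> z \<Longrightarrow> \<not> w \<epsilon> upair x y"
    using foundation[rule_format, of "upair x y"] mem_upair by blast
  then show False using \<open>x \<epsilon> y\<close> \<open>y \<epsilon> x\<close> by (auto simp: mem_upair)
qed

lemma zero_neq_succ [simp]: "emptyset \<noteq> succ n" "succ n \<noteq> emptyset"
  using mem_empty mem_succ by metis+

lemma succ_inject [simp]: "succ n = succ m \<longleftrightarrow> n = m"
  using mem_succ mem_asym by metis

text \<open>Natural numbers are ordered by \<open>\<epsilon>\<close>;
  \<open>m \<epsilon> succ n\<close> and, between numbers, \<open>m \<sqsubseteq> n\<close> express
  the weak order.\<close>

lemma less_trans:
  assumes "n \<epsilon> omega" "m \<epsilon> n" "k \<epsilon> m" shows "k \<epsilon> n"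
proof -
  from assms(1) have "\<forall>m k. m \<epsilon> n \<longrightarrow> k \<epsilon> m \<longrightarrow> k \<epsilon> n"
    by (induction rule: omega_induct) (auto simp: mem_empty mem_succ)
  then show ?thesis using assms by blast
qed

lemma less_omega:
  assumes "n \<epsilon> omega" "m \<epsilon> n" shows "m \<epsilon> omega"
proof -
  from assms(1) have "\<forall>m. m \<epsilon> n \<longrightarrow> m \<epsilon> omega"
    by (induction rule: omega_induct) (auto simp: mem_empty mem_succ)
  then show ?thesis using assms by blast
qed

lemma succ_le:
  assumes "n \<epsilon> omega" "m \<epsilon> n" shows "succ m \<epsilon> succ n"
proof -
  from assms(1) have "\<forall>m. m \<epsilon> n \<longrightarrow> succ m \<epsilon> succ n"
    by (induction rule: omega_induct) (auto simp: mem_empty mem_succ)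
  then show ?thesis using assms by blast
qed

lemma zero_le:
  assumes "n \<epsilon> omega" shows "emptyset \<epsilon> succ n"
  using assms by (induction rule: omega_induct) (auto simp: mem_succ)

lemma less_linear:
  assumes "n \<epsilon> omega" "m \<epsilon> omega" shows "n \<epsilon> m \<or> n = m \<or> m \<epsilon> n"
proof -
  from assms(2) show ?thesis
  proof (induction rule: omega_induct)
    case zero
    then show ?case using zero_le[OF assms(1)] by (auto simp: mem_succ)
  next
    case (succ m)
    then show ?case using succ_le[OF assms(1), of m] by (auto simp: mem_succ)
  qed simp
qed

text \<open>Foundation provides a minimal element, and linearity of the order makes it the least
  one.\<close>

lemma omega_least:
  assumes "defpred (\<lambda>e. Q (e 0))" "n \<epsilon> omega" "Q n"
  obtains k where "k \<epsilon> omega" "Q k" "\<And>m. m \<epsilon> omega \<Longrightarrow> Q m \<Longrightarrow> k \<epsilon> succ m"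
proof -
  obtain k where k: "k \<epsilon> sep omega Q" "\<And>m. m \<epsilon> k \<Longrightarrow> \<not> m \<epsilon> sep omega Q"
    using foundation[rule_format, of "sep omega Q"] assms by (auto simp: mem_sep)
  show ?thesis
  proof (rule that[of k])
    fix m assume "m \<epsilon> omega" "Q m"
    then show "k \<epsilon> succ m"
      using k less_linear[of k m] assms(1) by (auto simp: mem_sep mem_succ)
  qed (use k(1) assms(1) in \<open>auto simp: mem_sep\<close>)
qed

text \<open>Built on \<open>the1\<close>, so that the minimum is a definable term whether or not a
  witness exists. It takes the place of choice in the constructions below.\<close>

definition least :: "('m \<Rightarrow> bool) \<Rightarrow> 'm" where
  "least Q = the1 (\<lambda>k. k \<epsilon> omega \<and> Q k \<and> (\<forall>m. m \<epsilon> omega \<longrightarrow> Q m \<longrightarrow> k \<epsilon> succ m))"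

lemma defterm_least [simp]:
  assumes "defpred (\<lambda>e. Q (e 0) (\<lambda>n. e (Suc n)))"
  shows "defterm (\<lambda>e. least (\<lambda>y. Q y e))"
proof -
  have "defpred (\<lambda>e. Q (e 0) (\<lambda>n. e (Suc (Suc n))))"
    using defpred_subst[OF assms, of "case_nat (\<lambda>e. e 0) (\<lambda>n e. e (Suc (Suc n)))"] by simp
  then show ?thesis using assms unfolding least_def by simp
qed

lemma least:
  assumes "defpred (\<lambda>e. Q (e 0))" "n \<epsilon> omega" "Q n"
  shows "least Q \<epsilon> omega" "Q (least Q)" "least Q \<epsilon> succ n"
proof -
  obtain k where k: "k \<epsilon> omega" "Q k" "\<And>m. m \<epsilon> omega \<Longrightarrow> Q m \<Longrightarrow> k \<epsilon> succ m"
    using omega_least[OF assms] by blast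
  then have "least Q = k"
    unfolding least_def by (intro the1_eq) (auto simp: mem_succ dest: mem_asym)
  then show "least Q \<epsilon> omega" "Q (least Q)" "least Q \<epsilon> succ n" using k assms by auto
qed

lemma omega_recursion:
  assumes G: "defterm (\<lambda>e. G (e 0) (e 1))"
  obtains H where "defterm (\<lambda>e. H (e 0))" "H emptyset = z"
    "\<And>n. n \<epsilon> omega \<Longrightarrow> H (succ n) = G n (H n)"
proof -
  note [simp] = defterm_fun2[where F = G, OF G]
  \<comment> \<open>An approximation is a set in which every pair is the initial one or arises by
    \<open>G\<close> from another pair of the set. It need not be a function; uniqueness of values
    is obtained afterwards, by induction from \<open>R0\<close> and \<open>RS\<close>.\<close>
  define appr where "appr s \<longleftrightarrow> (\<forall>p. p \<epsilon> s \<longrightarrow> p = opair emptyset z \<or>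
      (\<exists>m w. m \<epsilon> omega \<and> p = opair (succ m) (G m w) \<and> opair m w \<epsilon> s))" for s
  define R where "R n y \<longleftrightarrow> (\<exists>s. opair n y \<epsilon> s \<and> appr s)" for n y
  define H where "H n = the1 (R n)" for n
  have defpred_R: "defpred (\<lambda>e. R (s e) (t e))" if "defterm s" "defterm t" for s t
    by (rule defpred_sub2[OF _ that]) (simp add: R_def appr_def)
  have R0: "R emptyset y \<longleftrightarrow> y = z" for y
  proof
    assume "y = z"
    then have "opair emptyset y \<epsilon> upair (opair emptyset z) (opair emptyset z)"
      "appr (upair (opair emptyset z) (opair emptyset z))"
      unfolding appr_def by (simp_all add: mem_upair)
    then show "R emptyset y" unfolding R_def by blast
  next
    assume "R emptyset y"
    then show "y = z" unfolding R_def appr_def by (metis opair_inject zero_neq_succ(1))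
  qed
  have RS: "R (succ n) y \<longleftrightarrow> (\<exists>w. R n w \<and> y = G n w)" if n: "n \<epsilon> omega" for n y
  proof
    assume "R (succ n) y"
    then obtain s where s: "opair (succ n) y \<epsilon> s" "appr s" unfolding R_def by blast
    then obtain w where "y = G n w" "opair n w \<epsilon> s"
      unfolding appr_def by (metis opair_inject succ_inject zero_neq_succ(1))
    then show "\<exists>w. R n w \<and> y = G n w" using s(2) unfolding R_def by blast
  next
    assume "\<exists>w. R n w \<and> y = G n w"
    then obtain w s where s: "opair n w \<epsilon> s" "appr s" "y = G n w" unfolding R_def by blast
    then have "appr (adj (opair (succ n) y) s)"
      unfolding appr_def by (auto simp: mem_adj n)
    then show "R (succ n) y" unfolding R_def by (blast intro: mem_adj[THEN iffD2])
  qed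
  have ex: "\<exists>!y. R n y" if "n \<epsilon> omega" for n
    using that by (induction rule: omega_induct) (auto simp: R0 RS defpred_R)
  then have H: "R n y \<longleftrightarrow> y = H n" if "n \<epsilon> omega" for n y
    unfolding H_def by (metis that the1_eq)
  show ?thesis
  proof (rule that[of H])
    show "defterm (\<lambda>e. H (e 0))" unfolding H_def by (simp add: defpred_R)
    show "H emptyset = z" using H R0 zero_omega by blast
    show "H (succ n) = G n (H n)" if "n \<epsilon> omega" for n
      using H[OF that] H[OF succ_omega[OF that]] RS[OF that] by metis
  qed
qed

section \<open>Finite sets\<close>

lemma lam_bijection:
  assumes "defterm (\<lambda>e. F (e 0))" "\<And>x. x \<epsilon> X \<Longrightarrow> F x \<epsilon> Y"
    and "\<And>x x'. x \<epsilon> X \<Longrightarrow> x' \<epsilon> X \<Longrightarrow> F x = F x' \<Longrightarrow> x = x'"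
    and "\<And>y. y \<epsilon> Y \<Longrightarrow> \<exists>x. x \<epsilon> X \<and> F x = y"
  shows "is_bijection (lam F X) X Y"
proof -
  have "\<exists>x. opair x y \<epsilon> lam F X" if "y \<epsilon> Y" for y
    using assms(4)[OF that] by (auto simp: mem_lam[where F = F, OF assms(1)])
  then show ?thesis unfolding is_bijection_def using lam_injection[OF assms(1-3)] by blast
qed

lemma bijection_app:
  assumes "is_bijection f X Y"
  shows "\<And>x. x \<epsilon> X \<Longrightarrow> app f x \<epsilon> Y"
    and "\<And>x x'. x \<epsilon> X \<Longrightarrow> x' \<epsilon> X \<Longrightarrow> app f x = app f x' \<Longrightarrow> x = x'"
    and "\<And>y. y \<epsilon> Y \<Longrightarrow> \<exists>x. x \<epsilon> X \<and> app f x = y"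
proof -
  have f: "is_function f X Y" and inj: "\<And>x x' y. opair x y \<epsilon> f \<Longrightarrow> opair x' y \<epsilon> f \<Longrightarrow> x = x'"
    and surj: "\<And>y. y \<epsilon> Y \<Longrightarrow> \<exists>x. opair x y \<epsilon> f"
    using assms unfolding is_bijection_def is_injection_def by blast+
  note a = app_mem[OF f]
  show "app f x \<epsilon> Y" if "x \<epsilon> X" for x using a(1)[OF that] .
  show "x = x'" if "x \<epsilon> X" "x' \<epsilon> X" "app f x = app f x'" for x x'
    using inj a(2)[OF that(1)] a(2)[OF that(2)] that(3) by metis
  show "\<exists>x. x \<epsilon> X \<and> app f x = y" if y: "y \<epsilon> Y" for y
  proof -
    obtain x where x: "opair x y \<epsilon> f" using surj[OF y] by blast
    then have "x \<epsilon> X" using f unfolding is_function_def by (metis opair_inject)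
    then show ?thesis using a(3)[of x y] x by auto
  qed
qed

lemma finite_empty [simp]: "is_finite emptyset"
proof -
  have "is_bijection (lam (\<lambda>x. x) emptyset) emptyset emptyset"
    by (rule lam_bijection) (simp_all add: mem_empty)
  then show ?thesis unfolding is_finite_def using zero_omega by blast
qed

lemma finite_adj [simp]:
  assumes "is_finite X" shows "is_finite (adj x X)"
proof (cases "x \<epsilon> X")
  case True
  then have "adj x X = X" by (intro setI) (auto simp: mem_adj)
  then show ?thesis using assms by simp
next
  case False
  obtain n f where n: "n \<epsilon> omega" and f: "is_bijection f X n"
    using assms unfolding is_finite_def by blast
  note a = bijection_app[OF f]
  have "is_bijection (lam (\<lambda>y. if y \<epsilon> X then app f y else n) (adj x X)) (adj x X) (succ n)"
  proof (rule lam_bijection)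
    show "(if y \<epsilon> X then app f y else n) \<epsilon> succ n" for y
      using a(1) by (simp add: mem_succ)
    show "y = y'" if "y \<epsilon> adj x X" "y' \<epsilon> adj x X"
      "(if y \<epsilon> X then app f y else n) = (if y' \<epsilon> X then app f y' else n)" for y y'
      using that a(2) a(1)[of y] a(1)[of y'] mem_irrefl[of n]
      by (auto simp: mem_adj split: if_splits)
    show "\<exists>y. y \<epsilon> adj x X \<and> (if y \<epsilon> X then app f y else n) = k" if "k \<epsilon> succ n" for k
      using that a(3)[of k] False by (auto simp: mem_adj mem_succ)
  qed simp
  then show ?thesis unfolding is_finite_def using succ_omega[OF n] by blast
qed

text \<open>Induction on the size: from a set in bijection with \<open>succ n\<close>, the element
  that is sent to the last index \<open>n\<close> is removed.\<close>

lemma is_finite_induct [consumes 1, case_names empty adj defpred]: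
  assumes "is_finite X" "Q emptyset" "\<And>x X. is_finite X \<Longrightarrow> Q X \<Longrightarrow> Q (adj x X)"
    and defpred: "defpred (\<lambda>e. Q (e 0))"
  shows "Q X"
proof -
  note [simp] = defpred_sub1[where Q = Q, OF defpred]
  have main: "\<forall>X f. is_bijection f X n \<longrightarrow> Q X" if "n \<epsilon> omega" for n
    using that
  proof (induction rule: omega_induct)
    case zero
    have "X = emptyset" if f: "is_bijection f X emptyset" for X f
      using bijection_app(1)[OF f] by (intro setI) (auto simp: mem_empty)
    then show ?case using assms(2) by blast
  next
    case (succ n)
    show ?case
    proof (intro allI impI)
      fix X f assume f: "is_bijection f X (succ n)"
      note a = bijection_app[OF f]
      obtain x where x: "x \<epsilon> X" "app f x = n" using a(3)[of n] by (auto simp: mem_succ)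
      define Y where "Y = sep X (\<lambda>y. y \<noteq> x)"
      have Y: "y \<epsilon> Y \<longleftrightarrow> y \<epsilon> X \<and> y \<noteq> x" for y unfolding Y_def by (simp add: mem_sep)
      have "is_bijection (lam (app f) Y) Y n"
      proof (rule lam_bijection)
        show "app f y \<epsilon> n" if "y \<epsilon> Y" for y
          using that a(1)[of y] a(2)[of y x] x by (auto simp: Y mem_succ)
        show "y = y'" if "y \<epsilon> Y" "y' \<epsilon> Y" "app f y = app f y'" for y y'
          using that a(2) by (auto simp: Y)
        show "\<exists>y. y \<epsilon> Y \<and> app f y = k" if "k \<epsilon> n" for k
          using that a(3)[of k] x mem_irrefl[of n] by (auto simp: Y mem_succ)
      qed simp
      then have "Q Y" "is_finite Y" using succ unfolding is_finite_def by blast+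
      then have "Q (adj x Y)" by (intro assms(3))
      moreover have "adj x Y = X" using x by (intro setI) (auto simp: Y mem_adj)
      ultimately show "Q X" by simp
    qed
  qed (simp add: is_bijection_def is_injection_def is_function_def)
  then show ?thesis using assms(1) unfolding is_finite_def by blast
qed

lemma finite_subset_of:
  assumes "is_finite Y" "X \<sqsubseteq> Y" shows "is_finite X"
proof -
  from assms(1) have "\<forall>X. X \<sqsubseteq> Y \<longrightarrow> is_finite X"
  proof (induction rule: is_finite_induct)
    case empty
    have "X = emptyset" if "X \<sqsubseteq> emptyset" for X
      using that by (intro setI) (auto simp: subset_of_def mem_empty)
    then show ?case by (metis finite_empty)
  next
    case (adj y Y)
    show ?case
    proof (intro allI impI)
      fix X assume X: "X \<sqsubseteq> adj y Y"
      define Z where "Z = sep X (\<lambda>x. x \<noteq> y)"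
      have Z: "x \<epsilon> Z \<longleftrightarrow> x \<epsilon> X \<and> x \<noteq> y" for x unfolding Z_def by (simp add: mem_sep)
      have "Z \<sqsubseteq> Y" using X by (auto simp: subset_of_def Z mem_adj)
      then have "is_finite Z" using adj by blast
      moreover have "X = Z \<or> X = adj y Z" unfolding ext_iff by (auto simp: Z mem_adj)
      ultimately show "is_finite X" by auto
    qed
  qed simp
  then show ?thesis using assms(2) by blast
qed

lemma finite_join [simp]:
  assumes "is_finite X" "is_finite Y" shows "is_finite (join X Y)"
  using assms(1)
proof (induction rule: is_finite_induct)
  case empty
  have "join emptyset Y = Y" by (rule setI) (simp add: mem_join mem_empty)
  then show ?case using assms(2) by simp
next
  case (adj x X)
  have "join (adj x X) Y = adj x (join X Y)" by (rule setI) (auto simp: mem_join mem_adj)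
  then show ?case using adj by simp
qed simp

lemma mem_UN: "defterm (\<lambda>e. F (e 0)) \<Longrightarrow> z \<epsilon> Union (img F I) \<longleftrightarrow> (\<exists>i. i \<epsilon> I \<and> z \<epsilon> F i)"
  by (auto simp: mem_Union mem_img)

lemma finite_UN:
  assumes "is_finite I" and F: "defterm (\<lambda>e. F (e 0))" and "\<And>i. i \<epsilon> I \<Longrightarrow> is_finite (F i)"
  shows "is_finite (Union (img F I))"
proof -
  note [simp] = defterm_fun1[where F = F, OF F]
  have UN: "z \<epsilon> Union (img F I) \<longleftrightarrow> (\<exists>i. i \<epsilon> I \<and> z \<epsilon> F i)" for z I
    by (rule mem_UN[where F = F, OF F])
  from assms(1) have "(\<forall>i. i \<epsilon> I \<longrightarrow> is_finite (F i)) \<longrightarrow> is_finite (Union (img F I))"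
  proof (induction rule: is_finite_induct)
    case empty
    have "Union (img F emptyset) = emptyset" by (rule setI) (simp add: UN mem_empty)
    then show ?case by simp
  next
    case (adj x I)
    have "Union (img F (adj x I)) = join (F x) (Union (img F I))"
      by (rule setI) (auto simp: UN mem_adj mem_join)
    then show ?case using adj by (simp add: mem_adj)
  qed simp
  then show ?thesis using assms(3) by blast
qed

lemma finite_img:
  assumes "is_finite X" and F: "defterm (\<lambda>e. F (e 0))"
  shows "is_finite (img F X)"
  using assms(1)
proof (induction rule: is_finite_induct)
  case empty
  have "img F emptyset = emptyset" by (rule setI) (simp add: mem_img F mem_empty)
  then show ?case by simp
next
  case (adj x X)
  have "img F (adj x X) = adj (F x) (img F X)" by (rule setI) (auto simp: mem_img F mem_adj)
  then show ?case using adj by simp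
qed (simp add: defterm_fun1[where F = F, OF F])

lemma finite_pow:
  assumes "is_finite X" shows "is_finite (pow X)"
  using assms
proof (induction rule: is_finite_induct)
  case empty
  have "pow emptyset = adj emptyset emptyset"
    by (rule setI) (auto simp: mem_pow mem_adj subset_of_def mem_empty ext_iff)
  then show ?case by simp
next
  case (adj x X)
  have "pow (adj x X) \<sqsubseteq> join (pow X) (img (adj x) (pow X))"
  proof -
    have "Y \<sqsubseteq> X \<or> (\<exists>Z. Z \<sqsubseteq> X \<and> Y = adj x Z)" if Y: "Y \<sqsubseteq> adj x X" for Y
    proof (cases "x \<epsilon> Y")
      case True
      have *: "y \<epsilon> sep Y (\<lambda>y. y \<noteq> x) \<longleftrightarrow> y \<epsilon> Y \<and> y \<noteq> x" for y by (simp add: mem_sep)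
      have "sep Y (\<lambda>y. y \<noteq> x) \<sqsubseteq> X" using Y by (auto simp: subset_of_def * mem_adj)
      moreover have "Y = adj x (sep Y (\<lambda>y. y \<noteq> x))" using True by (intro setI) (auto simp: * mem_adj)
      ultimately show ?thesis by blast
    next
      case False
      then show ?thesis using Y by (auto simp: subset_of_def mem_adj)
    qed
    then show ?thesis by (simp add: subset_of_def[of "pow _"] mem_pow mem_join mem_img)
  qed
  moreover have "is_finite (join (pow X) (img (adj x) (pow X)))"
    using adj by (simp add: finite_img)
  ultimately show ?case by (rule finite_subset_of[rotated])
qed simp

definition prod_set :: "'m \<Rightarrow> 'm \<Rightarrow> 'm" where
  "prod_set X Y = Union (img (\<lambda>x. img (opair x) Y) X)"

lemma mem_prod_set: "opair x y \<epsilon> prod_set X Y \<longleftrightarrow> x \<epsilon> X \<and> y \<epsilon> Y"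
  unfolding prod_set_def by (auto simp: mem_UN mem_img opair_inject)

lemma finite_prod_set: "is_finite X \<Longrightarrow> is_finite Y \<Longrightarrow> is_finite (prod_set X Y)"
  unfolding prod_set_def by (intro finite_UN) (simp_all add: finite_img)

lemma finite_omega: "n \<epsilon> omega \<Longrightarrow> is_finite n"
  by (induction rule: omega_induct) (simp_all add: succ_eq)

lemma omega_upper:
  assumes "n \<epsilon> omega" "m \<epsilon> omega"
  obtains k where "k \<epsilon> omega" "n \<sqsubseteq> k" "m \<sqsubseteq> k"
  using that[of n] that[of m] less_linear[OF assms] less_trans assms unfolding subset_of_def by blast

text \<open>A pigeonhole principle. By injectivity each new element \<open>z\<close> of the finite
  set is the value of at most one number in \<open>D\<close>, and the bound is raised beyond that
  number.\<close>

lemma finite_bounded: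
  assumes "is_finite Z" and G: "defterm (\<lambda>e. G (e 0))" and D: "defpred (\<lambda>e. D (e 0))"
    and inj: "\<And>n m. n \<epsilon> omega \<Longrightarrow> m \<epsilon> omega \<Longrightarrow> D n \<Longrightarrow> D m \<Longrightarrow> G n = G m \<Longrightarrow> n = m"
  shows "\<exists>N. N \<epsilon> omega \<and> (\<forall>n. n \<epsilon> omega \<longrightarrow> D n \<longrightarrow> G n \<epsilon> Z \<longrightarrow> n \<epsilon> N)"
  using assms(1)
proof (induction rule: is_finite_induct)
  case empty
  show ?case using zero_omega mem_empty by blast
next
  case (adj z Z)
  then obtain N where N: "N \<epsilon> omega" "\<And>n. n \<epsilon> omega \<Longrightarrow> D n \<Longrightarrow> G n \<epsilon> Z \<Longrightarrow> n \<epsilon> N" by blast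
  show ?case
  proof (cases "\<exists>n. n \<epsilon> omega \<and> D n \<and> G n = z")
    case True
    then obtain n where n: "n \<epsilon> omega" "D n" "G n = z" by blast
    obtain k where k: "k \<epsilon> omega" "N \<sqsubseteq> k" "succ n \<sqsubseteq> k"
      using omega_upper[OF N(1) succ_omega[OF n(1)]] by blast
    then have "n \<epsilon> k" by (auto simp: subset_of_def mem_succ)
    then have "m \<epsilon> k" if "m \<epsilon> omega" "D m" "G m \<epsilon> adj z Z" for m
      using that N(2)[of m] k(2) inj[of m n] n by (auto simp: mem_adj subset_of_def)
    then show ?thesis using k(1) by blast
  next
    case False
    then show ?thesis using N by (auto simp: mem_adj)
  qed
qed (simp add: defterm_fun1[where F = G, OF G] defpred_sub1[where Q = D, OF D])

section \<open>Unbounded maps to \<open>\<omega>\<close>\<close>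

text \<open>Dependent choice along \<open>omega\<close>, available without choice because the least
  suitable \<open>k\<close> can be taken at each step of a recursion.\<close>

lemma thinning:
  assumes R: "defpred (\<lambda>e. R (e 0) (e 1))"
    and step: "\<And>m. m \<epsilon> omega \<Longrightarrow> \<exists>k. k \<epsilon> omega \<and> m \<epsilon> k \<and> R m k"
  obtains h where "defterm (\<lambda>e. h (e 0))" "\<And>n. n \<epsilon> omega \<Longrightarrow> h n \<epsilon> omega"
    "\<And>n. n \<epsilon> omega \<Longrightarrow> R (h n) (h (succ n))"
    "\<And>n m. n \<epsilon> omega \<Longrightarrow> m \<epsilon> n \<Longrightarrow> h m \<epsilon> h n"
proof -
  note [simp] = defpred_sub2[where Q = R, OF R]
  define J where "J n w = least (\<lambda>k. w \<epsilon> k \<and> R w k)" for n w :: 'm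
  have "defterm (\<lambda>e. J (e 0) (e 1))" unfolding J_def by simp
  then obtain h where h: "defterm (\<lambda>e. h (e 0))" "h emptyset = emptyset"
    "\<And>n. n \<epsilon> omega \<Longrightarrow> h (succ n) = J n (h n)"
    by (rule omega_recursion[where z = emptyset]) blast
  note [simp] = defterm_fun1[where F = h, OF h(1)]
  have J: "J n w \<epsilon> omega" "w \<epsilon> J n w" "R w (J n w)" if w: "w \<epsilon> omega" for n w
  proof -
    obtain k where k: "k \<epsilon> omega" "w \<epsilon> k \<and> R w k" using step[OF w] by blast
    have "defpred (\<lambda>e. w \<epsilon> e 0 \<and> R w (e 0))" by simp
    from least(1,2)[where Q = "\<lambda>k. w \<epsilon> k \<and> R w k", OF this k]
    show "J n w \<epsilon> omega" "w \<epsilon> J n w" "R w (J n w)" unfolding J_def by blast+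
  qed
  have hw: "h n \<epsilon> omega" if "n \<epsilon> omega" for n
    using that by (induction rule: omega_induct) (simp_all add: h J)
  have mono: "\<forall>m. m \<epsilon> n \<longrightarrow> h m \<epsilon> h n" if "n \<epsilon> omega" for n
    using that
  proof (induction rule: omega_induct)
    case (succ n)
    have "h n \<epsilon> h (succ n)" using J(2)[OF hw] succ by (simp add: h(3))
    then show ?case
      using succ less_trans[OF hw[OF succ_omega[OF succ.hyps]]] by (auto simp: mem_succ)
  qed (simp_all add: mem_empty)
  show ?thesis
    by (rule that[of h]) (use h hw mono J in auto)
qed

text \<open>Definability is part of the notion: it lets replacement turn the restriction of
  \<open>u\<close> to \<open>X\<close> into a function of the structure.\<close>

definition unbounded_on :: "'m \<Rightarrow> ('m \<Rightarrow> 'm) \<Rightarrow> bool" where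
  "unbounded_on X u \<longleftrightarrow> defterm (\<lambda>e. u (e 0)) \<and> (\<forall>x. x \<epsilon> X \<longrightarrow> u x \<epsilon> omega) \<and>
     (\<forall>n. n \<epsilon> omega \<longrightarrow> (\<exists>x. x \<epsilon> X \<and> n \<epsilon> u x))"

lemma not_unbounded_on_bounded:
  assumes "\<And>u. \<not> unbounded_on X u" "defterm (\<lambda>e. u (e 0))" "\<And>x. x \<epsilon> X \<Longrightarrow> u x \<epsilon> omega"
  shows "\<exists>N. N \<epsilon> omega \<and> (\<forall>x. x \<epsilon> X \<longrightarrow> u x \<epsilon> N)"
proof -
  obtain n where n: "n \<epsilon> omega" "\<And>x. x \<epsilon> X \<Longrightarrow> \<not> n \<epsilon> u x"
    using assms unfolding unbounded_on_def by blast
  then have "u x \<epsilon> succ n" if "x \<epsilon> X" for x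
    using that assms(3) less_linear[of "u x" n] by (auto simp: mem_succ)
  then show ?thesis using n(1) succ_omega by blast
qed

lemma unbounded_enumeration:
  assumes "unbounded_on X u"
  obtains h where "defterm (\<lambda>e. h (e 0))" "\<And>n. n \<epsilon> omega \<Longrightarrow> \<exists>x. x \<epsilon> X \<and> u x = h n"
    "\<And>n m. n \<epsilon> omega \<Longrightarrow> m \<epsilon> omega \<Longrightarrow> h n = h m \<Longrightarrow> n = m"
proof -
  have u: "defterm (\<lambda>e. u (e 0))" "\<And>x. x \<epsilon> X \<Longrightarrow> u x \<epsilon> omega"
    "\<And>n. n \<epsilon> omega \<Longrightarrow> \<exists>x. x \<epsilon> X \<and> n \<epsilon> u x"
    using assms unfolding unbounded_on_def by blast+
  note [simp] = defterm_fun1[where F = u, OF u(1)]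
  have R: "defpred (\<lambda>e. \<exists>x. x \<epsilon> X \<and> u x = e 1)" by simp
  have step: "\<exists>k. k \<epsilon> omega \<and> m \<epsilon> k \<and> (\<exists>x. x \<epsilon> X \<and> u x = k)" if "m \<epsilon> omega" for m
    using u(2) u(3)[OF that] by blast
  obtain h where h: "defterm (\<lambda>e. h (e 0))"
    "\<And>n. n \<epsilon> omega \<Longrightarrow> \<exists>x. x \<epsilon> X \<and> u x = h (succ n)"
    "\<And>n m. n \<epsilon> omega \<Longrightarrow> m \<epsilon> n \<Longrightarrow> h m \<epsilon> h n"
    by (rule thinning[where R = "\<lambda>m k. \<exists>x. x \<epsilon> X \<and> u x = k", OF R step]) blast+
  note [simp] = defterm_fun1[where F = h, OF h(1)]
  have "n = m" if "n \<epsilon> omega" "m \<epsilon> omega" "h (succ n) = h (succ m)" for n m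
    using that less_linear[of "succ n" "succ m"] h(3)[of "succ n" "succ m"] h(3)[of "succ m" "succ n"]
      mem_irrefl by auto
  \<comment> \<open>The starting point of the thinned sequence need not be a value of
    \<open>u\<close>, so the enumeration begins one step later.\<close>
  then show ?thesis using that[of "\<lambda>n. h (succ n)"] h(2) by simp
qed

text \<open>The fibres of \<open>u\<close> over the enumerated values are nonempty and pairwise
  disjoint, hence distinct subsets of \<open>X\<close>.\<close>

lemma unbounded_power_dedekind_infinite:
  assumes "unbounded_on X u" shows "power_dedekind_infinite X"
proof -
  obtain h where h: "defterm (\<lambda>e. h (e 0))" "\<And>n. n \<epsilon> omega \<Longrightarrow> \<exists>x. x \<epsilon> X \<and> u x = h n"
    "\<And>n m. n \<epsilon> omega \<Longrightarrow> m \<epsilon> omega \<Longrightarrow> h n = h m \<Longrightarrow> n = m"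
    using unbounded_enumeration[OF assms] by blast
  have u: "defterm (\<lambda>e. u (e 0))" using assms unfolding unbounded_on_def by blast
  note [simp] = defterm_fun1[where F = u, OF u] defterm_fun1[where F = h, OF h(1)]
  have F: "x \<epsilon> sep X (\<lambda>x. u x = h n) \<longleftrightarrow> x \<epsilon> X \<and> u x = h n" for x n by (simp add: mem_sep)
  show ?thesis
    unfolding power_dedekind_infinite_def dedekind_infinite_def
  proof (rule injects_intoI)
    show "defterm (\<lambda>e. sep X (\<lambda>x. u x = h (e 0)))" by simp
    show "sep X (\<lambda>x. u x = h n) \<epsilon> pow X" for n by (simp add: mem_pow subset_of_def F)
    show "n = m" if "n \<epsilon> omega" "m \<epsilon> omega" "sep X (\<lambda>x. u x = h n) = sep X (\<lambda>x. u x = h m)" for n m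
      using that h(2)[of n] h(3)[of n m] F by metis
  qed
qed

text \<open>By \<open>dist\<close> the maps \<open>q \<mapsto> F q n\<close> are pairwise different
  on \<open>X\<close>. If every map from \<open>X\<close> to \<open>omega\<close> were bounded, they
  could be coded by elements of a single finite set.\<close>

lemma bounded_sequences_unbounded:
  assumes F: "defterm (\<lambda>e. F (e 0) (e 1))" and Fw: "\<And>q n. q \<epsilon> X \<Longrightarrow> n \<epsilon> omega \<Longrightarrow> F q n \<epsilon> omega"
    and bdd: "\<And>q. q \<epsilon> X \<Longrightarrow> \<exists>N. N \<epsilon> omega \<and> (\<forall>n. n \<epsilon> omega \<longrightarrow> F q n \<epsilon> N)"
    and dist: "\<And>n m. n \<epsilon> omega \<Longrightarrow> m \<epsilon> omega \<Longrightarrow> n \<noteq> m \<Longrightarrow> \<exists>q. q \<epsilon> X \<and> F q n \<noteq> F q m"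
  shows "\<exists>u. unbounded_on X u"
proof (rule ccontr)
  note [simp] = defterm_fun2[where F = F, OF F]
  assume "\<nexists>u. unbounded_on X u"
  then have nu: "\<And>u. \<not> unbounded_on X u" by blast
  obtain b where b: "b \<epsilon> omega" "\<And>q n. q \<epsilon> X \<Longrightarrow> n \<epsilon> omega \<Longrightarrow> F q n \<epsilon> b"
  proof -
    \<comment> \<open>The least bound of each sequence is itself a map to \<open>omega\<close>, and
      a bound of this map bounds all sequences at once.\<close>
    define u where "u q = least (\<lambda>N. \<forall>n. n \<epsilon> omega \<longrightarrow> F q n \<epsilon> N)" for q
    have u: "u q \<epsilon> omega" "\<And>n. n \<epsilon> omega \<Longrightarrow> F q n \<epsilon> u q" if q: "q \<epsilon> X" for q
    proof -
      obtain N where N: "N \<epsilon> omega" "\<forall>n. n \<epsilon> omega \<longrightarrow> F q n \<epsilon> N" using bdd[OF q] by blast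
      have "defpred (\<lambda>e. \<forall>n. n \<epsilon> omega \<longrightarrow> F q n \<epsilon> e 0)" by simp
      from least(1,2)[where Q = "\<lambda>N. \<forall>n. n \<epsilon> omega \<longrightarrow> F q n \<epsilon> N", OF this N]
      show "u q \<epsilon> omega" "\<And>n. n \<epsilon> omega \<Longrightarrow> F q n \<epsilon> u q" unfolding u_def by blast+
    qed
    have "defterm (\<lambda>e. u (e 0))" unfolding u_def by simp
    from not_unbounded_on_bounded[OF nu this u(1)]
    obtain N where "N \<epsilon> omega" "\<And>x. x \<epsilon> X \<Longrightarrow> u x \<epsilon> N" by blast
    then show ?thesis using u(2) less_trans by (intro that[of N]) blast+
  qed
  define agree where "agree q q' k \<longleftrightarrow> (\<forall>i. i \<epsilon> k \<longrightarrow> F q i = F q' i)" for q q' k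
  have defpred_agree [simp]: "defpred (\<lambda>e. agree (s e) (t e) (v e))" if "defterm s" "defterm t" "defterm v" for s t v
    by (rule defpred_sub3[OF _ that]) (simp add: agree_def)
  \<comment> \<open>\<open>N\<close> is a common modulus: sequences that agree below
    \<open>N\<close> agree everywhere. If every \<open>q\<close> has a modulus of its own, the least
    ones form a map to \<open>omega\<close>, whose bound serves all \<open>q\<close>.\<close>
  obtain N where N: "N \<epsilon> omega"
    "\<And>q q'. q \<epsilon> X \<Longrightarrow> q' \<epsilon> X \<Longrightarrow> agree q q' N \<Longrightarrow> agree q q' omega"
  proof (cases "\<forall>q. q \<epsilon> X \<longrightarrow> (\<exists>k. k \<epsilon> omega \<and> (\<forall>q'. q' \<epsilon> X \<longrightarrow> agree q q' k \<longrightarrow> agree q q' omega))")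
    case True
    define u where "u q = least (\<lambda>k. \<forall>q'. q' \<epsilon> X \<longrightarrow> agree q q' k \<longrightarrow> agree q q' omega)" for q
    have u: "u q \<epsilon> omega" "\<And>q'. q' \<epsilon> X \<Longrightarrow> agree q q' (u q) \<Longrightarrow> agree q q' omega" if q: "q \<epsilon> X" for q
    proof -
      obtain k where k: "k \<epsilon> omega" "\<forall>q'. q' \<epsilon> X \<longrightarrow> agree q q' k \<longrightarrow> agree q q' omega"
        using True q by blast
      have "defpred (\<lambda>e. \<forall>q'. q' \<epsilon> X \<longrightarrow> agree q q' (e 0) \<longrightarrow> agree q q' omega)" by simp
      from least(1,2)[where Q = "\<lambda>k. \<forall>q'. q' \<epsilon> X \<longrightarrow> agree q q' k \<longrightarrow> agree q q' omega", OF this k]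
      show "u q \<epsilon> omega" "\<And>q'. q' \<epsilon> X \<Longrightarrow> agree q q' (u q) \<Longrightarrow> agree q q' omega"
        unfolding u_def by blast+
    qed
    have "defterm (\<lambda>e. u (e 0))" unfolding u_def by simp
    from not_unbounded_on_bounded[OF nu this u(1)]
    obtain N where N: "N \<epsilon> omega" "\<And>x. x \<epsilon> X \<Longrightarrow> u x \<epsilon> N" by blast
    show ?thesis
    proof (rule that[OF N(1)])
      fix q q' assume q: "q \<epsilon> X" "q' \<epsilon> X" "agree q q' N"
      then have "agree q q' (u q)" unfolding agree_def using less_trans[OF N(1) N(2)[OF q(1)]] by blast
      then show "agree q q' omega" using u(2) q by blast
    qed
  next
    case False
    then obtain p where p: "p \<epsilon> X"
      "\<And>k. k \<epsilon> omega \<Longrightarrow> \<exists>q. q \<epsilon> X \<and> agree p q k \<and> \<not> agree p q omega" by blast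
    \<comment> \<open>Here \<open>p\<close> has no modulus, and \<open>u q\<close> is the first
      place where \<open>q\<close> differs from \<open>p\<close>; \<open>emptyset\<close> is a
      default value when there is none. A bound \<open>N\<close> of \<open>u\<close> is refuted by
      some \<open>q\<close> that agrees with \<open>p\<close> below \<open>N\<close> but not
      everywhere.\<close>
    define u where "u q = (if agree p q omega then emptyset else least (\<lambda>i. F p i \<noteq> F q i))" for q
    have u: "u q \<epsilon> omega" "\<not> agree p q omega \<Longrightarrow> F p (u q) \<noteq> F q (u q)" for q
    proof -
      have "u q \<epsilon> omega \<and> (\<not> agree p q omega \<longrightarrow> F p (u q) \<noteq> F q (u q))"
      proof (cases "agree p q omega")
        case False
        then obtain i where i: "i \<epsilon> omega" "F p i \<noteq> F q i" unfolding agree_def by blast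
        have "defpred (\<lambda>e. F p (e 0) \<noteq> F q (e 0))" by simp
        from least(1,2)[where Q = "\<lambda>i. F p i \<noteq> F q i", OF this i] show ?thesis
          using False unfolding u_def by simp
      qed (simp add: u_def)
      then show "u q \<epsilon> omega" "\<not> agree p q omega \<Longrightarrow> F p (u q) \<noteq> F q (u q)" by blast+
    qed
    have "defterm (\<lambda>e. u (e 0))" unfolding u_def by simp
    from not_unbounded_on_bounded[OF nu this u(1)]
    obtain N where N: "N \<epsilon> omega" "\<And>x. x \<epsilon> X \<Longrightarrow> u x \<epsilon> N" by blast
    obtain q where "q \<epsilon> X" "agree p q N" "\<not> agree p q omega" using p(2)[OF N(1)] by blast
    then have False using N(2) u(2) unfolding agree_def by blast
    then show ?thesis ..
  qed
  \<comment> \<open>\<open>C q\<close> codes \<open>q\<close> by the graph of its sequence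
    restricted to \<open>N\<close>, and \<open>V n\<close> is the graph of the map taking the code
    of \<open>q\<close> to \<open>F q n\<close>. Thus \<open>V n\<close> is a set of pairs of a
    subset of \<open>N \<times> b\<close> and an element of \<open>b\<close>, which leaves finitely
    many possibilities.\<close>
  define C where "C q = img (\<lambda>i. opair i (F q i)) N" for q
  define V where "V n = img (\<lambda>q. opair (C q) (F q n)) X" for n
  have dtC [simp]: "defterm (\<lambda>e. C (s e))" if "defterm s" for s
    by (rule defterm_fun1[OF _ that]) (simp add: C_def)
  have dtV [simp]: "defterm (\<lambda>e. V (s e))" if "defterm s" for s
    by (rule defterm_fun1[OF _ that]) (simp add: V_def)
  have memC: "z \<epsilon> C q \<longleftrightarrow> (\<exists>i. i \<epsilon> N \<and> z = opair i (F q i))" for z q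
    unfolding C_def by (rule mem_img) simp
  have memV: "z \<epsilon> V n \<longleftrightarrow> (\<exists>q. q \<epsilon> X \<and> z = opair (C q) (F q n))" for z n
    unfolding V_def by (rule mem_img) simp
  define Z where "Z = pow (prod_set (pow (prod_set N b)) b)"
  have "is_finite Z" unfolding Z_def using N b by (intro finite_pow finite_prod_set finite_omega)
  moreover have "V n \<epsilon> Z" if "n \<epsilon> omega" for n
  proof -
    have "C q \<epsilon> pow (prod_set N b)" if "q \<epsilon> X" for q
      using b(2)[OF that] less_omega[OF N(1)]
      unfolding mem_pow subset_of_def memC by (auto simp: mem_prod_set)
    then show ?thesis
      unfolding Z_def mem_pow[of "V n"] subset_of_def[of "V n"] memV using b(2) that
      by (auto simp: mem_prod_set)
  qed
  moreover have "n = m" if nm: "n \<epsilon> omega" "m \<epsilon> omega" "V n = V m" for n m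
  proof (rule ccontr)
    assume "n \<noteq> m"
    \<comment> \<open>The pair contributed by \<open>q\<close> to \<open>V n\<close> comes in
      \<open>V m\<close> from some \<open>q'\<close> with the same code, hence with the same
      sequence. So \<open>F q n = F q' m = F q m\<close>, contrary to the choice of
      \<open>q\<close>.\<close>
    then obtain q where q: "q \<epsilon> X" "F q n \<noteq> F q m" using dist nm by blast
    then have "opair (C q) (F q n) \<epsilon> V m" unfolding nm(3)[symmetric] memV by blast
    then obtain q' where q': "q' \<epsilon> X" "C q = C q'" "F q n = F q' m"
      unfolding memV opair_inject by blast
    have "agree q q' N"
      unfolding agree_def
    proof (intro allI impI)
      fix i assume "i \<epsilon> N"
      then have "opair i (F q i) \<epsilon> C q'" unfolding q'(2)[symmetric] memC by blast
      then show "F q i = F q' i" unfolding memC opair_inject by blast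
    qed
    then have "F q m = F q' m" using N(2) q(1) q'(1) nm(2) unfolding agree_def[of _ _ omega] by blast
    with q' q show False by simp
  qed
  ultimately obtain K where "K \<epsilon> omega" "\<And>n. n \<epsilon> omega \<Longrightarrow> n \<epsilon> K"
    using finite_bounded[of Z V "\<lambda>n. True"] by (auto simp: defpred_const)
  then show False using mem_irrefl by blast
qed

lemma power_dedekind_infinite_unbounded:
  assumes "power_dedekind_infinite X"
  shows "\<exists>u. unbounded_on X u"
proof -
  obtain S where S: "defterm (\<lambda>e. S (e 0))" "\<And>n. n \<epsilon> omega \<Longrightarrow> S n \<epsilon> pow X"
    "\<And>n m. n \<epsilon> omega \<Longrightarrow> m \<epsilon> omega \<Longrightarrow> S n = S m \<Longrightarrow> n = m"
    using assms unfolding power_dedekind_infinite_def dedekind_infinite_def by (rule injects_intoE) blast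
  note [simp] = defterm_fun1[where F = S, OF S(1)]
  let ?F = "\<lambda>q n. if q \<epsilon> S n then emptyset else succ emptyset"
  show ?thesis
  proof (rule bounded_sequences_unbounded[where F = ?F])
    show "\<exists>N. N \<epsilon> omega \<and> (\<forall>n. n \<epsilon> omega \<longrightarrow> ?F q n \<epsilon> N)" for q
      by (rule exI[of _ "succ (succ emptyset)"]) (simp add: mem_succ)
    show "\<exists>q. q \<epsilon> X \<and> ?F q n \<noteq> ?F q m" if "n \<epsilon> omega" "m \<epsilon> omega" "n \<noteq> m" for n m
    proof -
      have "S n \<noteq> S m" using S(3) that by blast
      then obtain q where "q \<epsilon> S n \<longleftrightarrow> \<not> q \<epsilon> S m" unfolding ext_iff by blast
      moreover have "q \<epsilon> X"
        using S(2)[OF that(1)] S(2)[OF that(2)] calculation unfolding mem_pow subset_of_def by blast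
      ultimately show ?thesis by auto
    qed
  qed simp_all
qed

section \<open>Finitary partitions\<close>

lemma finitary_partitionD:
  assumes "P \<epsilon> finitary_partitions A"
  shows "b \<epsilon> P \<Longrightarrow> x \<epsilon> b \<Longrightarrow> x \<epsilon> A" and "b \<epsilon> P \<Longrightarrow> is_finite b"
    and "b \<epsilon> P \<Longrightarrow> \<exists>x. x \<epsilon> b" and "x \<epsilon> A \<Longrightarrow> \<exists>b. b \<epsilon> P \<and> x \<epsilon> b"
    and "b \<epsilon> P \<Longrightarrow> c \<epsilon> P \<Longrightarrow> x \<epsilon> b \<Longrightarrow> x \<epsilon> c \<Longrightarrow> b = c"
proof -
  have P: "is_partition A P" and f: "b \<epsilon> P \<Longrightarrow> is_finite b" for b
    using assms unfolding mem_finitary_partitions is_finitary_partition_def by blast+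
  show sub: "b \<epsilon> P \<Longrightarrow> x \<epsilon> b \<Longrightarrow> x \<epsilon> A" for b x
    using P unfolding is_partition_def subset_of_def by blast
  show "b \<epsilon> P \<Longrightarrow> is_finite b" by (rule f)
  show "b \<epsilon> P \<Longrightarrow> \<exists>x. x \<epsilon> b" using P unfolding is_partition_def by blast
  have ex1: "x \<epsilon> A \<Longrightarrow> \<exists>!b. b \<epsilon> P \<and> x \<epsilon> b" for x using P unfolding is_partition_def by blast
  show "x \<epsilon> A \<Longrightarrow> \<exists>b. b \<epsilon> P \<and> x \<epsilon> b" using ex1 by blast
  show "b \<epsilon> P \<Longrightarrow> c \<epsilon> P \<Longrightarrow> x \<epsilon> b \<Longrightarrow> x \<epsilon> c \<Longrightarrow> b = c"
    using ex1[of x] sub[of b x] by blast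
qed

section \<open>Partitions from equivalence relations\<close>

definition quotient :: "'m \<Rightarrow> ('m \<Rightarrow> 'm \<Rightarrow> bool) \<Rightarrow> 'm" where
  "quotient A R = img (\<lambda>x. sep A (R x)) A"

context
  fixes A :: 'm and R :: "'m \<Rightarrow> 'm \<Rightarrow> bool"
  assumes pdR: "defpred (\<lambda>e. R (e 0) (e 1))"
    and equivR: "equivp R"
begin

lemma mem_class: "y \<epsilon> sep A (R x) \<longleftrightarrow> y \<epsilon> A \<and> R x y"
  by (rule mem_sep) (simp add: defpred_sub2[where Q = R, OF pdR])

lemma mem_quotient: "b \<epsilon> quotient A R \<longleftrightarrow> (\<exists>x. x \<epsilon> A \<and> b = sep A (R x))"
  unfolding quotient_def by (rule mem_img) (simp add: defpred_sub2[where Q = R, OF pdR])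

lemma quotient_related:
  assumes "x \<epsilon> A" "y \<epsilon> A"
  shows "(\<exists>b. b \<epsilon> quotient A R \<and> x \<epsilon> b \<and> y \<epsilon> b) \<longleftrightarrow> R x y"
proof
  assume "\<exists>b. b \<epsilon> quotient A R \<and> x \<epsilon> b \<and> y \<epsilon> b"
  then obtain z where "z \<epsilon> A" "R z x" "R z y" unfolding mem_quotient by (auto simp: mem_class)
  then show "R x y" using equivp_symp[OF equivR] equivp_transp[OF equivR] by blast
next
  assume "R x y"
  then have "x \<epsilon> sep A (R x)" "y \<epsilon> sep A (R x)" using assms equivp_reflp[OF equivR] by (simp_all add: mem_class)
  then show "\<exists>b. b \<epsilon> quotient A R \<and> x \<epsilon> b \<and> y \<epsilon> b" unfolding mem_quotient using assms by blast
qed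

lemma quotient_finitary:
  assumes "\<And>x. x \<epsilon> A \<Longrightarrow> is_finite (sep A (R x))"
  shows "quotient A R \<epsilon> finitary_partitions A"
proof -
  have "\<exists>!b. b \<epsilon> quotient A R \<and> a \<epsilon> b" if a: "a \<epsilon> A" for a
  proof (rule ex1I[of _ "sep A (R a)"])
    show "sep A (R a) \<epsilon> quotient A R \<and> a \<epsilon> sep A (R a)"
      unfolding mem_quotient mem_class using a equivp_reflp[OF equivR] by blast
    fix b assume "b \<epsilon> quotient A R \<and> a \<epsilon> b"
    then obtain x where x: "x \<epsilon> A" "b = sep A (R x)" "R x a" unfolding mem_quotient by (auto simp: mem_class)
    then show "b = sep A (R a)"
      unfolding x(2) using equivp_symp[OF equivR x(3)] equivp_transp[OF equivR] x(3)
      by (intro setI) (unfold mem_class, blast)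
  qed
  moreover have "b \<sqsubseteq> A \<and> (\<exists>a. a \<epsilon> b) \<and> is_finite b" if b: "b \<epsilon> quotient A R" for b
  proof -
    obtain x where x: "x \<epsilon> A" "b = sep A (R x)" using b unfolding mem_quotient by blast
    then have "x \<epsilon> b" using equivp_reflp[OF equivR] by (simp add: mem_class)
    moreover have "b \<sqsubseteq> A" unfolding x(2) subset_of_def mem_class by blast
    ultimately show ?thesis using assms x by blast
  qed
  ultimately show ?thesis
    unfolding mem_finitary_partitions is_finitary_partition_def is_partition_def by blast
qed

end

text \<open>Here the relation depends on a parameter, and its quotient is a definable function of
  this parameter.\<close>

lemma defterm_quotient [simp]:
  assumes "\<And>s t v. defterm s \<Longrightarrow> defterm t \<Longrightarrow> defterm v \<Longrightarrow> defpred (\<lambda>e. R (s e) (t e) (v e))" "defterm s"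
  shows "defterm (\<lambda>e. quotient A (R (s e)))"
  by (rule defterm_fun1[OF _ assms(2)]) (simp add: quotient_def assms(1))

lemma finite_singleton [simp]: "is_finite (upair x x)"
proof -
  have "upair x x = adj x emptyset" by (rule setI) (simp add: mem_upair mem_adj mem_empty)
  then show ?thesis by simp
qed

text \<open>The set \<open>S\<close> can be read off from the partition it produces: for each
  \<open>n \<epsilon> S\<close> some block with \<open>u\<close>-value \<open>h n\<close> remains
  whole, and having two elements it differs from a block that was split into singletons.\<close>

lemma unbounded_injects:
  assumes P: "P \<epsilon> finitary_partitions A" and u: "unbounded_on (ns P) u"
  shows "injects_into (pow omega) (finitary_partitions A)"
proof -
  obtain h where h: "defterm (\<lambda>e. h (e 0))" "\<And>n. n \<epsilon> omega \<Longrightarrow> \<exists>b. b \<epsilon> ns P \<and> u b = h n"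
    "\<And>n m. n \<epsilon> omega \<Longrightarrow> m \<epsilon> omega \<Longrightarrow> h n = h m \<Longrightarrow> n = m"
    using unbounded_enumeration[OF u] by blast
  have "defterm (\<lambda>e. u (e 0))" using u unfolding unbounded_on_def by blast
  note [simp] = defterm_fun1[where F = u, OF this] defterm_fun1[where F = h, OF h(1)]
  note PD = finitary_partitionD[OF P]
  define R where "R S x y \<longleftrightarrow> x = y \<or>
      (\<exists>b. b \<epsilon> ns P \<and> (\<exists>n. n \<epsilon> S \<and> u b = h n) \<and> x \<epsilon> b \<and> y \<epsilon> b)" for S x y
  have pdR: "defpred (\<lambda>e. R (s e) (t e) (v e))" if "defterm s" "defterm t" "defterm v" for s t v
    by (rule defpred_sub3[OF _ that]) (simp add: R_def)
  have pdRS: "defpred (\<lambda>e. R S (e 0) (e 1))" for S by (simp add: pdR)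
  have equivR: "equivp (R S)" for S
  proof (rule equivpI)
    show "transp (R S)"
    proof (rule transpI)
      fix x y z assume "R S x y" "R S y z"
      then show "R S x z" unfolding R_def mem_ns using PD(5)[where x = y] by blast
    qed
    show "symp (R S)" by (rule sympI) (unfold R_def, blast)
  qed (simp add: R_def reflpI)
  note qr = quotient_related[OF pdRS equivR]
  show ?thesis
  proof (rule injects_intoI)
    show "defterm (\<lambda>e. quotient A (R (e 0)))" by (rule defterm_quotient) (simp_all add: pdR)
    show "quotient A (R S) \<epsilon> finitary_partitions A" for S
    proof (rule quotient_finitary[OF pdRS equivR])
      fix x assume "x \<epsilon> A"
      then obtain b where b: "b \<epsilon> P" "x \<epsilon> b" using PD(4) by blast
      have "y \<epsilon> b" if "R S x y" for y
        using that b PD(5) unfolding R_def mem_ns by blast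
      then have "sep A (R S x) \<sqsubseteq> b" unfolding subset_of_def by (simp add: mem_sep pdR)
      then show "is_finite (sep A (R S x))" by (rule finite_subset_of[OF PD(2)[OF b(1)]])
    qed
    \<comment> \<open>By symmetry one inclusion suffices. Two distinct points of a block
      \<open>b\<close> kept for \<open>n\<close> must also be related by \<open>R S'\<close>; the
      block relating them can only be \<open>b\<close>, and injectivity of \<open>h\<close> gives
      \<open>n \<epsilon> S'\<close>.\<close>
    have sub: "S \<sqsubseteq> S'" if S: "S \<sqsubseteq> omega" "S' \<sqsubseteq> omega" and eq: "quotient A (R S) = quotient A (R S')" for S S'
      unfolding subset_of_def
    proof (intro allI impI)
      fix n assume n: "n \<epsilon> S"
      then have nw: "n \<epsilon> omega" using S unfolding subset_of_def by blast
      obtain b where b: "b \<epsilon> ns P" "u b = h n" using h(2)[OF nw] by blast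
      obtain x y where xy: "x \<epsilon> b" "y \<epsilon> b" "x \<noteq> y" using b(1) unfolding mem_ns by blast
      have A: "x \<epsilon> A" "y \<epsilon> A" using b(1) xy PD(1) unfolding mem_ns by blast+
      have "R S x y" unfolding R_def using b n xy by blast
      then have "R S' x y" using qr[OF A, of S] qr[OF A, of S'] unfolding eq by blast
      then obtain c m where c: "c \<epsilon> ns P" "m \<epsilon> S'" "u c = h m" "x \<epsilon> c" unfolding R_def using xy(3) by blast
      then have "c = b" using PD(5) b(1) xy(1) unfolding mem_ns by blast
      moreover have "m \<epsilon> omega" using S(2) c(2) unfolding subset_of_def by blast
      ultimately have "m = n" using h(3) nw b(2) c(3) by simp
      then show "n \<epsilon> S'" using c(2) by simp
    qed
    show "S = S'" if "S \<epsilon> pow omega" "S' \<epsilon> pow omega" "quotient A (R S) = quotient A (R S')" for S S'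
    proof -
      have "S \<sqsubseteq> S'" "S' \<sqsubseteq> S" using sub that unfolding mem_pow by simp_all
      then show ?thesis unfolding subset_of_def ext_iff by blast
    qed
  qed
qed

text \<open>The successive differences \<open>L n\<close> are finite, pairwise disjoint and have at
  least two elements. They become blocks, and all remaining points of \<open>A\<close>, among them
  those of \<open>D emptyset\<close>, become singletons.\<close>

lemma chain_partition:
  assumes D: "defterm (\<lambda>e. D (e 0))" and fin: "\<And>n. n \<epsilon> omega \<Longrightarrow> is_finite (D n)"
    and sub: "\<And>n. n \<epsilon> omega \<Longrightarrow> D n \<sqsubseteq> A"
    and mono: "\<And>n m. n \<epsilon> omega \<Longrightarrow> m \<epsilon> n \<Longrightarrow> D m \<sqsubseteq> D n"
    and two: "\<And>n. n \<epsilon> omega \<Longrightarrow> \<exists>x y. x \<epsilon> D (succ n) \<and> y \<epsilon> D (succ n) \<and> x \<noteq> y \<and> \<not> x \<epsilon> D n \<and> \<not> y \<epsilon> D n"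
  shows "\<exists>P. P \<epsilon> finitary_partitions A \<and> power_dedekind_infinite (ns P)"
proof -
  note [simp] = defterm_fun1[where F = D, OF D]
  define L where "L n = sep (D (succ n)) (\<lambda>x. \<not> x \<epsilon> D n)" for n
  have L: "x \<epsilon> L n \<longleftrightarrow> x \<epsilon> D (succ n) \<and> \<not> x \<epsilon> D n" for x n
    unfolding L_def by (simp add: mem_sep)
  have [simp]: "defterm (\<lambda>e. L (s e))" if "defterm s" for s
    by (rule defterm_fun1[OF _ that]) (simp add: L_def)
  have LA: "x \<epsilon> A" if "x \<epsilon> L n" "n \<epsilon> omega" for x n
    using that sub[OF succ_omega] unfolding L subset_of_def by blast
  have disj: "n = m" if nm: "n \<epsilon> omega" "m \<epsilon> omega" "x \<epsilon> L n" "x \<epsilon> L m" for x n m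
  proof -
    \<comment> \<open>If \<open>m\<close> is below \<open>n\<close>, then \<open>L m\<close> lies in
      \<open>D (succ m)\<close> and hence in \<open>D n\<close>, which \<open>L n\<close>
      avoids.\<close>
    have *: "\<not> m \<epsilon> n" if "n \<epsilon> omega" "m \<epsilon> omega" "x \<epsilon> L n" "x \<epsilon> L m" for n m
    proof
      assume "m \<epsilon> n"
      then have "succ m \<epsilon> n \<or> succ m = n" using succ_le[OF that(1)] by (auto simp: mem_succ)
      then have "D (succ m) \<sqsubseteq> D n" using mono[OF that(1)] by (auto simp: subset_of_def)
      then show False using that(3,4) unfolding L subset_of_def by blast
    qed
    show ?thesis using *[of n m] *[of m n] nm less_linear[of n m] by blast
  qed
  define R where "R x y \<longleftrightarrow> x = y \<or> (\<exists>n. n \<epsilon> omega \<and> x \<epsilon> L n \<and> y \<epsilon> L n)" for x y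
  have pdR: "defpred (\<lambda>e. R (s e) (t e))" if "defterm s" "defterm t" for s t
    by (rule defpred_sub2[OF _ that]) (simp add: R_def)
  have "equivp R"
  proof (rule equivpI)
    show "transp R"
    proof (rule transpI)
      fix x y z assume "R x y" "R y z"
      then show "R x z" unfolding R_def using disj by blast
    qed
    show "symp R" by (rule sympI) (unfold R_def, blast)
  qed (simp add: R_def reflpI)
  moreover have "defpred (\<lambda>e. R (e 0) (e 1))" by (simp add: pdR)
  ultimately have eqv: "defpred (\<lambda>e. R (e 0) (e 1))" "equivp R" by blast+
  have "quotient A R \<epsilon> finitary_partitions A"
  proof (rule quotient_finitary[OF eqv])
    fix x
    show "is_finite (sep A (R x))"
    proof (cases "\<exists>n. n \<epsilon> omega \<and> x \<epsilon> L n")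
      case True
      then obtain n where n: "n \<epsilon> omega" "x \<epsilon> L n" by blast
      then have "y \<epsilon> D (succ n)" if "R x y" for y
        using that disj unfolding R_def L by blast
      then have "sep A (R x) \<sqsubseteq> D (succ n)" unfolding subset_of_def by (simp add: mem_sep pdR)
      then show ?thesis by (rule finite_subset_of[OF fin[OF succ_omega[OF n(1)]]])
    next
      case False
      then have "y = x" if "R x y" for y using that unfolding R_def by blast
      then have "sep A (R x) \<sqsubseteq> upair x x" unfolding subset_of_def by (simp add: mem_sep pdR mem_upair)
      then show ?thesis by (rule finite_subset_of[OF finite_singleton])
    qed
  qed
  moreover have "L n \<epsilon> ns (quotient A R)" if n: "n \<epsilon> omega" for n
  proof -
    obtain x y where xy: "x \<epsilon> L n" "y \<epsilon> L n" "x \<noteq> y" using two[OF n] unfolding L by blast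
    have "sep A (R x) = L n"
    proof (rule setI)
      fix z
      have "z \<epsilon> A \<and> R x z \<longleftrightarrow> z \<epsilon> L n" using xy(1) n LA disj unfolding R_def by blast
      then show "z \<epsilon> sep A (R x) \<longleftrightarrow> z \<epsilon> L n" by (simp add: mem_sep pdR)
    qed
    then have "L n \<epsilon> quotient A R" unfolding mem_quotient[OF eqv] using LA[OF xy(1) n] by metis
    then show ?thesis unfolding mem_ns using xy by blast
  qed
  then have "injects_into omega (pow (ns (quotient A R)))"
  proof (intro injects_intoI)
    \<comment> \<open>The singletons of the blocks \<open>L n\<close> turn a sequence of blocks into
      a sequence of sets of blocks.\<close>
    show "defterm (\<lambda>e. upair (L (e 0)) (L (e 0)))" by simp
    show "n = m" if nm: "n \<epsilon> omega" "m \<epsilon> omega" "upair (L n) (L n) = upair (L m) (L m)" for n m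
    proof -
      have "L n = L m" using nm(3) mem_upair by metis
      moreover obtain x where "x \<epsilon> L n" using two[OF nm(1)] unfolding L by blast
      ultimately show ?thesis using disj nm by metis
    qed
  qed (auto simp: mem_pow subset_of_def mem_upair)
  ultimately show ?thesis unfolding power_dedekind_infinite_def dedekind_infinite_def by blast
qed

section \<open>The equivalence relation generated by a sequence of finitary partitions\<close>

context
  fixes A :: 'm and G :: "'m \<Rightarrow> 'm"
  assumes G: "defterm (\<lambda>e. G (e 0))"
    and GP: "\<And>n. n \<epsilon> omega \<Longrightarrow> G n \<epsilon> finitary_partitions A"
begin

definition rel :: "'m \<Rightarrow> 'm \<Rightarrow> 'm \<Rightarrow> bool" where
  "rel n x y \<longleftrightarrow> (\<exists>b. b \<epsilon> G n \<and> x \<epsilon> b \<and> y \<epsilon> b)"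

text \<open>These are the unions of classes of the generated equivalence relation. Working with them
  avoids an explicit transitive closure.\<close>

definition closed_set :: "'m \<Rightarrow> bool" where
  "closed_set S \<longleftrightarrow> S \<sqsubseteq> A \<and> (\<forall>n x y. n \<epsilon> omega \<longrightarrow> x \<epsilon> S \<longrightarrow> rel n x y \<longrightarrow> y \<epsilon> S)"

lemma defterm_G: "defterm s \<Longrightarrow> defterm (\<lambda>e. G (s e))"
  using defterm_fun1[where F = G, OF G] .

lemma defpred_rel: "defterm s \<Longrightarrow> defterm t \<Longrightarrow> defterm v \<Longrightarrow> defpred (\<lambda>e. rel (s e) (t e) (v e))"
  by (rule defpred_sub3) (simp_all add: rel_def defterm_G)

lemma rel_class_finite:
  assumes "n \<epsilon> omega" shows "is_finite (sep A (rel n x))"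
proof (cases "\<exists>b. b \<epsilon> G n \<and> x \<epsilon> b")
  case True
  then obtain b where b: "b \<epsilon> G n" "x \<epsilon> b" by blast
  have "y \<epsilon> b" if "rel n x y" for y
    using that b finitary_partitionD(5)[OF GP[OF assms]] unfolding rel_def by blast
  then have "sep A (rel n x) \<sqsubseteq> b" unfolding subset_of_def by (simp add: mem_sep defpred_rel)
  then show ?thesis by (rule finite_subset_of[OF finitary_partitionD(2)[OF GP[OF assms] b(1)]])
next
  case False
  then have "sep A (rel n x) = emptyset"
    by (intro setI) (simp add: mem_sep defpred_rel mem_empty, auto simp: rel_def)
  then show ?thesis by simp
qed

text \<open>The class \<open>C\<close> of \<open>a\<close> is exhausted by an increasing sequence of
  finite stages \<open>B n\<close>. Either \<open>C\<close> is finite, or the stages can be thinned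
  out to a chain as in \<open>chain_partition\<close>.\<close>

lemma finite_closed_or_partition:
  assumes a: "a \<epsilon> A"
  shows "(\<exists>C. closed_set C \<and> a \<epsilon> C \<and> is_finite C) \<or>
    (\<exists>P. P \<epsilon> finitary_partitions A \<and> power_dedekind_infinite (ns P))"
proof -
  note [simp] = defpred_rel
  \<comment> \<open>One stage adds all blocks of \<open>G i\<close> that meet \<open>W\<close>, for
    \<open>i\<close> up to and including \<open>n\<close>. Only finitely many partitions act at a
    time, which keeps the stages finite, but each of them acts at all later stages.\<close>
  define J where "J n W = Union (img (\<lambda>i. Union (img (\<lambda>x. sep A (rel i x)) W)) (succ n))" for n W
  have J: "y \<epsilon> J n W \<longleftrightarrow> (\<exists>i x. i \<epsilon> succ n \<and> x \<epsilon> W \<and> y \<epsilon> A \<and> rel i x y)" for y n W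
    unfolding J_def by (simp add: mem_UN mem_sep)
  have "defterm (\<lambda>e. J (e 0) (e 1))" unfolding J_def by simp
  then obtain B where B: "defterm (\<lambda>e. B (e 0))" "B emptyset = upair a a"
    "\<And>n. n \<epsilon> omega \<Longrightarrow> B (succ n) = J n (B n)"
    by (rule omega_recursion[where z = "upair a a"]) blast
  note [simp] = defterm_fun1[where F = B, OF B(1)]
  have fin: "is_finite (B n)" if "n \<epsilon> omega" for n
    using that
  proof (induction rule: omega_induct)
    case (succ n)
    show ?case
      unfolding B(3)[OF succ.hyps] J_def
      using succ less_omega[OF succ_omega[OF succ.hyps]]
      by (intro finite_UN rel_class_finite) (simp_all add: finite_omega)
  qed (simp_all add: B(2))
  have sub: "B n \<sqsubseteq> A" if n: "n \<epsilon> omega" for n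
    using n by (cases rule: omega_cases) (auto simp: subset_of_def B J mem_upair a)
  have step: "B n \<sqsubseteq> B (succ n)" if n: "n \<epsilon> omega" for n
    unfolding subset_of_def
  proof (intro allI impI)
    fix x assume x: "x \<epsilon> B n"
    then have "x \<epsilon> A" using sub[OF n] unfolding subset_of_def by blast
    moreover from this have "rel n x x" using finitary_partitionD(4)[OF GP[OF n]] unfolding rel_def by blast
    ultimately show "x \<epsilon> B (succ n)" unfolding B(3)[OF n] J mem_succ using x by blast
  qed
  have "\<forall>m. m \<epsilon> n \<longrightarrow> B m \<sqsubseteq> B n" if "n \<epsilon> omega" for n
    using that
  proof (induction rule: omega_induct)
    case (succ n)
    then show ?case using step[OF succ.hyps] by (auto simp: mem_succ subset_of_def)
  qed (simp_all add: mem_empty)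
  then have mono: "B m \<sqsubseteq> B n" if "n \<epsilon> omega" "m \<epsilon> n" for n m using that by blast
  have mono': "B m \<sqsubseteq> B n" if "n \<epsilon> omega" "m \<epsilon> omega" "m \<sqsubseteq> n" for n m
    using mono[of n m] that less_linear[of n m] mem_irrefl[of n] unfolding subset_of_def by blast
  define C where "C = Union (img B omega)"
  have C: "x \<epsilon> C \<longleftrightarrow> (\<exists>n. n \<epsilon> omega \<and> x \<epsilon> B n)" for x
    unfolding C_def by (simp add: mem_UN)
  have "a \<epsilon> C" unfolding C using B(2) by (intro exI[of _ emptyset]) (simp add: mem_upair)
  moreover have "closed_set C"
    unfolding closed_set_def
  proof (intro conjI allI impI)
    show "C \<sqsubseteq> A" using sub by (auto simp: subset_of_def C)
    fix n x y assume n: "n \<epsilon> omega" and x: "x \<epsilon> C" and r: "rel n x y"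
    obtain m where m: "m \<epsilon> omega" "x \<epsilon> B m" using x unfolding C by blast
    \<comment> \<open>The stage \<open>k\<close> is chosen so late that \<open>x\<close> has
      appeared and that \<open>G n\<close> takes part in the next step.\<close>
    obtain k where k: "k \<epsilon> omega" "m \<sqsubseteq> k" "succ n \<sqsubseteq> k" using omega_upper[OF m(1) succ_omega[OF n]] by blast
    have "y \<epsilon> A" using r finitary_partitionD(1)[OF GP[OF n]] unfolding rel_def by blast
    moreover have "n \<epsilon> succ k" using k(3) by (simp add: subset_of_def mem_succ)
    moreover have "x \<epsilon> B k" using mono'[OF k(1) m(1) k(2)] m(2) unfolding subset_of_def by blast
    ultimately have "y \<epsilon> B (succ k)" unfolding B(3)[OF k(1)] J using r by blast
    then show "y \<epsilon> C" unfolding C using succ_omega[OF k(1)] by blast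
  qed
  moreover have "\<exists>P. P \<epsilon> finitary_partitions A \<and> power_dedekind_infinite (ns P)" if inf: "\<not> is_finite C"
  proof -
    define T where "T m k \<longleftrightarrow> (\<exists>x y. x \<epsilon> B k \<and> y \<epsilon> B k \<and> x \<noteq> y \<and> \<not> x \<epsilon> B m \<and> \<not> y \<epsilon> B m)" for m k
    have pdT: "defpred (\<lambda>e. T (e 0) (e 1))" unfolding T_def by simp
    have T: "\<exists>k. k \<epsilon> omega \<and> m \<epsilon> k \<and> T m k" if m: "m \<epsilon> omega" for m
    proof -
      \<comment> \<open>An infinite \<open>C\<close> is contained neither in \<open>B m\<close> nor
        in \<open>B m\<close> with one more point, which yields two new points. Both belong to some
        stage \<open>l\<close> beyond \<open>m\<close>.\<close>
      have "\<not> C \<sqsubseteq> B m" using inf finite_subset_of[OF fin[OF m]] by blast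
      then obtain x where x: "x \<epsilon> C" "\<not> x \<epsilon> B m" unfolding subset_of_def by blast
      have "\<not> C \<sqsubseteq> adj x (B m)" using inf finite_subset_of[OF finite_adj[OF fin[OF m]]] by blast
      then obtain y where y: "y \<epsilon> C" "y \<noteq> x" "\<not> y \<epsilon> B m" unfolding subset_of_def mem_adj by blast
      obtain i where i: "i \<epsilon> omega" "x \<epsilon> B i" using x(1) unfolding C by blast
      obtain j where j: "j \<epsilon> omega" "y \<epsilon> B j" using y(1) unfolding C by blast
      obtain k where k: "k \<epsilon> omega" "i \<sqsubseteq> k" "j \<sqsubseteq> k" using omega_upper[OF i(1) j(1)] by blast
      obtain l where l: "l \<epsilon> omega" "k \<sqsubseteq> l" "succ m \<sqsubseteq> l" using omega_upper[OF k(1) succ_omega[OF m]] by blast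
      have "x \<epsilon> B l" "y \<epsilon> B l"
        using mono'[OF k(1) i(1) k(2)] mono'[OF k(1) j(1) k(3)] mono'[OF l(1) k(1) l(2)] i(2) j(2)
        unfolding subset_of_def by blast+
      moreover have "m \<epsilon> l" using l(3) by (simp add: subset_of_def mem_succ)
      ultimately show ?thesis unfolding T_def using l(1) x y by blast
    qed
    obtain h where h: "defterm (\<lambda>e. h (e 0))" "\<And>n. n \<epsilon> omega \<Longrightarrow> h n \<epsilon> omega"
      "\<And>n. n \<epsilon> omega \<Longrightarrow> T (h n) (h (succ n))" "\<And>n m. n \<epsilon> omega \<Longrightarrow> m \<epsilon> n \<Longrightarrow> h m \<epsilon> h n"
      by (rule thinning[where R = T, OF pdT T]) blast+
    show ?thesis
    proof (rule chain_partition[where D = "\<lambda>n. B (h n)"])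
      show "defterm (\<lambda>e. B (h (e 0)))" using h(1) by simp
    qed (use fin sub mono h(2,4) h(3)[unfolded T_def] in blast)+
  qed
  ultimately show ?thesis by blast
qed

text \<open>The generated equivalence has finite classes, so they form a finitary partition
  \<open>?Q\<close> refined by every \<open>G n\<close>. Different partitions \<open>G n\<close>
  already differ on some block of \<open>?Q\<close>, while a single block admits only finitely many
  restrictions.\<close>

lemma finite_closed_unbounded:
  assumes cl: "\<And>a. a \<epsilon> A \<Longrightarrow> \<exists>C. closed_set C \<and> a \<epsilon> C \<and> is_finite C"
    and inj: "\<And>n m. n \<epsilon> omega \<Longrightarrow> m \<epsilon> omega \<Longrightarrow> G n = G m \<Longrightarrow> n = m"
  shows "\<exists>P u. P \<epsilon> finitary_partitions A \<and> unbounded_on (ns P) u"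
proof -
  note [simp] = defpred_rel defterm_G
  \<comment> \<open>On \<open>A\<close>, lying in the same closed sets is the generated equivalence.
    Its classes are finite because each of them is contained in a finite closed set.\<close>
  define R where "R x y \<longleftrightarrow> (\<forall>S. closed_set S \<longrightarrow> (x \<epsilon> S \<longleftrightarrow> y \<epsilon> S))" for x y
  have pdR: "defpred (\<lambda>e. R (s e) (t e))" if "defterm s" "defterm t" for s t
    by (rule defpred_sub2[OF _ that]) (simp add: R_def closed_set_def)
  have eqv: "defpred (\<lambda>e. R (e 0) (e 1))" "equivp R"
    by (simp add: pdR) (auto simp: R_def intro!: equivpI reflpI sympI transpI)
  have relA: "x \<epsilon> A" "y \<epsilon> A" if "n \<epsilon> omega" "rel n x y" for n x y
    using that(2) finitary_partitionD(1)[OF GP[OF that(1)]] unfolding rel_def by blast+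
  have relR: "R x y" if "n \<epsilon> omega" "rel n x y" for n x y
    using that unfolding R_def closed_set_def rel_def by blast
  have relsym: "rel n x y \<Longrightarrow> rel n y x" for n x y unfolding rel_def by blast
  have relrefl: "rel n x x" if "n \<epsilon> omega" "x \<epsilon> A" for n x
    using finitary_partitionD(4)[OF GP] that unfolding rel_def by blast
  let ?Q = "quotient A R"
  have Q: "?Q \<epsilon> finitary_partitions A"
  proof (rule quotient_finitary[OF eqv])
    fix x assume "x \<epsilon> A"
    then obtain C where C: "closed_set C" "x \<epsilon> C" "is_finite C" using cl by blast
    then have "z \<epsilon> C" if "R x z" for z using that unfolding R_def by blast
    then have "sep A (R x) \<sqsubseteq> C" unfolding subset_of_def by (simp add: mem_sep pdR)
    then show "is_finite (sep A (R x))" by (rule finite_subset_of[OF C(3)])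
  qed
  have QR: "z \<epsilon> q" if "q \<epsilon> ?Q" "x \<epsilon> q" "R x z" "z \<epsilon> A" for q x z
    using that equivp_transp[OF eqv(2)] unfolding mem_quotient[OF eqv] by (auto simp: mem_class[OF eqv])
  define agree where "agree q n m \<longleftrightarrow> (\<forall>x y. x \<epsilon> q \<longrightarrow> y \<epsilon> q \<longrightarrow> (rel n x y \<longleftrightarrow> rel m x y))" for q n m
  \<comment> \<open>\<open>F q n\<close> is the canonical index of the restriction of
    \<open>G n\<close> to the block \<open>q\<close>.\<close>
  define F where "F q n = least (agree q n)" for q n
  have [simp]: "defpred (\<lambda>e. agree (s e) (t e) (v e))" if "defterm s" "defterm t" "defterm v" for s t v
    by (rule defpred_sub3[OF _ that]) (simp add: agree_def)
  have [simp]: "defterm (\<lambda>e. F (s e) (t e))" if "defterm s" "defterm t" for s t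
    by (rule defterm_fun2[OF _ that]) (simp add: F_def)
  have F: "F q n \<epsilon> omega" "agree q n (F q n)" if n: "n \<epsilon> omega" for q n
    using least(1,2)[where Q = "agree q n", OF _ n] by (simp_all add: F_def agree_def[of q n n])
  have Fcong: "F q n = F q m" if "agree q n m" for q n m
  proof -
    have "agree q n = agree q m" using that unfolding agree_def by (intro ext) blast
    then show ?thesis unfolding F_def by simp
  qed
  have "\<exists>u. unbounded_on (ns ?Q) u"
  proof (rule bounded_sequences_unbounded[where F = F])
    show "defterm (\<lambda>e. F (e 0) (e 1))" by simp
    show "F q n \<epsilon> omega" if "n \<epsilon> omega" for q n using F(1)[OF that] .
    fix q assume "q \<epsilon> ns ?Q"
    then have q: "q \<epsilon> ?Q" unfolding mem_ns by blast
    \<comment> \<open>Since \<open>q\<close> is a union of blocks of \<open>G m\<close>, the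
      restriction of \<open>G m\<close> to \<open>q\<close> is the set of blocks contained in
      \<open>q\<close>.\<close>
    define H where "H m = sep (G m) (\<lambda>b. b \<sqsubseteq> q)" for m
    have H: "b \<epsilon> H m \<longleftrightarrow> b \<epsilon> G m \<and> b \<sqsubseteq> q" for b m unfolding H_def by (simp add: mem_sep)
    have relH: "rel m x y \<longleftrightarrow> (\<exists>b. b \<epsilon> H m \<and> x \<epsilon> b \<and> y \<epsilon> b)" if m: "m \<epsilon> omega" and x: "x \<epsilon> q" for m x y
    proof
      assume "rel m x y"
      then obtain b where b: "b \<epsilon> G m" "x \<epsilon> b" "y \<epsilon> b" unfolding rel_def by blast
      have "z \<epsilon> q" if "z \<epsilon> b" for z
      proof -
        have "rel m x z" unfolding rel_def using b that by blast
        then show ?thesis using QR[OF q x] relR[OF m] relA[OF m] by blast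
      qed
      then show "\<exists>b. b \<epsilon> H m \<and> x \<epsilon> b \<and> y \<epsilon> b" unfolding H subset_of_def using b by blast
    qed (auto simp: rel_def H)
    \<comment> \<open>The values of \<open>F q\<close> are fixed by \<open>F q\<close>, so two of
      them with the same restriction \<open>H\<close> are equal. As \<open>H\<close> takes values in
      a finite set, these values are bounded.\<close>
    let ?D = "\<lambda>m. \<exists>n. n \<epsilon> omega \<and> F q n = m"
    have "\<exists>N. N \<epsilon> omega \<and> (\<forall>m. m \<epsilon> omega \<longrightarrow> ?D m \<longrightarrow> H m \<epsilon> pow (pow q) \<longrightarrow> m \<epsilon> N)"
    proof (rule finite_bounded)
      show "is_finite (pow (pow q))" using finitary_partitionD(2)[OF Q q] by (intro finite_pow)
      show "defterm (\<lambda>e. H (e 0))" unfolding H_def by simp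
      show "defpred (\<lambda>e. \<exists>n. n \<epsilon> omega \<and> F q n = e 0)" by simp
      fix n m assume nm: "n \<epsilon> omega" "m \<epsilon> omega" "?D n" "?D m" "H n = H m"
      have idem: "F q k = k" if "?D k" for k using that F(2) Fcong by metis
      have "agree q n m" unfolding agree_def using relH[OF nm(1)] relH[OF nm(2)] nm(5) by simp
      then show "n = m" using Fcong idem nm(3,4) by metis
    qed
    moreover have "H m \<epsilon> pow (pow q)" for m unfolding mem_pow subset_of_def[of "H m"] H by blast
    ultimately show "\<exists>N. N \<epsilon> omega \<and> (\<forall>n. n \<epsilon> omega \<longrightarrow> F q n \<epsilon> N)" using F(1) by blast
  next
    fix n m assume nm: "n \<epsilon> omega" "m \<epsilon> omega" "n \<noteq> m"
    \<comment> \<open>A partition is determined by its relation, because a block is the class of any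
      of its elements.\<close>
    have G_sub: "b \<epsilon> G m" if nm: "n \<epsilon> omega" "m \<epsilon> omega" and eq: "\<And>x y. rel n x y \<longleftrightarrow> rel m x y" and b: "b \<epsilon> G n" for n m b
    proof -
      obtain x where x: "x \<epsilon> b" "x \<epsilon> A" using finitary_partitionD(1,3)[OF GP[OF nm(1)] b] by blast
      obtain c where c: "c \<epsilon> G m" "x \<epsilon> c" using finitary_partitionD(4)[OF GP[OF nm(2)] x(2)] by blast
      have "y \<epsilon> b \<longleftrightarrow> rel n x y" for y
        unfolding rel_def using finitary_partitionD(5)[OF GP[OF nm(1)]] b x(1) by blast
      moreover have "y \<epsilon> c \<longleftrightarrow> rel m x y" for y
        unfolding rel_def using finitary_partitionD(5)[OF GP[OF nm(2)]] c by blast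
      ultimately have "b = c" using eq by (intro setI) blast
      then show ?thesis using c by simp
    qed
    have "\<exists>x y. rel n x y \<noteq> rel m x y"
    proof (rule ccontr)
      assume "\<nexists>x y. rel n x y \<noteq> rel m x y"
      then have "G n = G m" using G_sub[of n m] G_sub[of m n] nm by (intro setI) blast
      then show False using inj nm by blast
    qed
    then obtain x y where xy: "rel n x y \<noteq> rel m x y" by blast
    then have A: "x \<epsilon> A" "y \<epsilon> A" and "R x y" using relA relR nm by blast+
    then obtain q where q: "q \<epsilon> ?Q" "x \<epsilon> q" "y \<epsilon> q" using quotient_related[OF eqv, of x A y] by blast
    \<comment> \<open>Both relations are reflexive on \<open>A\<close>, so they differ off the
      diagonal; this is what makes \<open>q\<close> a block with more than one element.\<close>
    have "x \<noteq> y" using xy relrefl nm A by blast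
    with q have "q \<epsilon> ns ?Q" unfolding mem_ns by blast
    moreover have "F q n \<noteq> F q m"
      using F(2)[OF nm(1), of q] F(2)[OF nm(2), of q] xy q unfolding agree_def by metis
    ultimately show "\<exists>q. q \<epsilon> ns ?Q \<and> F q n \<noteq> F q m" by blast
  qed
  then show ?thesis using Q by blast
qed

end

end

section \<open>Equivalence of the three conditions\<close>

theorem theorem4p13:
  fixes mem :: "'m \<Rightarrow> 'm \<Rightarrow> bool" and A :: 'm
  assumes "ZF_model mem"
  shows "(set_structure.dedekind_infinite mem (set_structure.finitary_partitions mem A) \<longleftrightarrow>
           (\<exists>P. mem P (set_structure.finitary_partitions mem A) \<and>
                set_structure.power_dedekind_infinite mem (set_structure.ns mem P)))
       \<and> ((\<exists>P. mem P (set_structure.finitary_partitions mem A) \<and>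
                set_structure.power_dedekind_infinite mem (set_structure.ns mem P)) \<longleftrightarrow>
           set_structure.injects_into mem
             (set_structure.pow mem (set_structure.omega mem))
             (set_structure.finitary_partitions mem A))"
proof -
  interpret ZF_model mem by (rule assms)
  let ?ii = "\<exists>P. mem P (finitary_partitions A) \<and> power_dedekind_infinite (ns P)"
  have i_ii: ?ii if i: "dedekind_infinite (finitary_partitions A)"
  proof -
    obtain G where G: "defterm (\<lambda>e. G (e 0))" "\<And>n. mem n omega \<Longrightarrow> mem (G n) (finitary_partitions A)"
      "\<And>n m. mem n omega \<Longrightarrow> mem m omega \<Longrightarrow> G n = G m \<Longrightarrow> n = m"
      using i unfolding dedekind_infinite_def by (rule injects_intoE) blast
    show ?ii
    proof (rule ccontr)
      \<comment> \<open>Failure of (ii) excludes the infinite case of the dichotomy for every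
        \<open>a\<close>. Then all generated classes are finite, which produces an unbounded map on
        some \<open>ns P\<close> and so (ii) after all.\<close>
      assume no: "\<not> ?ii"
      then have "\<exists>C. closed_set A G C \<and> mem a C \<and> is_finite C" if "mem a A" for a
        using finite_closed_or_partition[OF G(1,2) that] by blast
      then show False
        using no finite_closed_unbounded[OF G(1,2) _ G(3)] unbounded_power_dedekind_infinite by blast
    qed
  qed
  have ii_iii: "injects_into (pow omega) (finitary_partitions A)" if ?ii
    using that power_dedekind_infinite_unbounded unbounded_injects by blast
  have iii_i: "dedekind_infinite (finitary_partitions A)"
    if iii: "injects_into (pow omega) (finitary_partitions A)"
  proof -
    obtain G where G: "defterm (\<lambda>e. G (e 0))" "\<And>n. mem n (pow omega) \<Longrightarrow> mem (G n) (finitary_partitions A)"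
      "\<And>n m. mem n (pow omega) \<Longrightarrow> mem m (pow omega) \<Longrightarrow> G n = G m \<Longrightarrow> n = m"
      using iii by (rule injects_intoE) blast
    \<comment> \<open>Each natural number is a subset of \<open>omega\<close>, so \<open>G\<close>
      can be restricted from \<open>pow omega\<close> to \<open>omega\<close>.\<close>
    have "mem n (pow omega)" if "mem n omega" for n
      using less_omega[OF that] by (simp add: mem_pow subset_of_def)
    then show ?thesis
      unfolding dedekind_infinite_def using G by (intro injects_intoI[where F = G]) blast+
  qed
  show ?thesis using i_ii ii_iii iii_i by blast
qed

end
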